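(* If $\mathcal{A}\subset\mathbb{P}^n$ is any hyperplane arrangement and $\ell\in[S]_1$ is a general linear form, then $(f_{\mathcal{A}},\frac{\partial f_{\mathcal{A}}}{\partial\ell})$ is a complete intersection with a minimal primary decomposition $$\Big(f_{\mathcal{A}},\frac{\partial f_{\mathcal{A}}}{\partial\ell}\Big)=\bigcap_{P\in S(\mathcal{A})}\Big(g_P,\frac{\partial g_P}{\partial\ell}\Big).$$ In particular, one has $$|\mathcal{A}|\cdot(|\mathcal{A}|-1)=\sum_{P\in S(\mathcal{A})}t_P(t_P-1).$$
   Context: $K$ is a field of characteristic zero, $S=K[x_0,\dots,x_n]$ with the standard grading. A hyperplane arrangement $\mathcal{A}\subset\mathbb{P}^n$ is a finite set of distinct hyperplanes, $|\mathcal{A}|$ is their number, and $f_{\mathcal{A}}$ is the (squarefree) product of linear forms defining them. For a linear form $\ell=\sum a_ix_i$, put $\frac{\partial f}{\partial\ell}=\sum_i a_i\frac{\partial f}{\partial x_i}$. "General $\ell$" means $\ell$ in a suitable nonempty Zariski-open subset of $[S]_1$ depending on $\mathcal{A}$. $S(\mathcal{A})=\{H\cap H' : H\neq H'\in\mathcal{A}\}$ is a set of codimension two linear subspaces. For $P\in S(\mathcal{A})$ with homogeneous ideal $I_P$, $g_P$ is the product of the linear factors of $f_{\mathcal{A}}$ contained in $I_P$, and $t_P=\deg g_P$ is the number of hyperplanes of $\mathcal{A}$ containing $P$. *)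

theory Defs
  imports "HOL-Analysis.Analysis" "HOL-Library.Poly_Mapping"
begin

text \<open>
  The polynomial ring \<open>S = K[x\<^sub>0,\<dots>,x\<^sub>n]\<close> is the type of finitely supported functions from
  exponent vectors to \<open>K\<close>. The variables are indexed by a finite linearly ordered type \<open>'n\<close>
  with \<open>CARD('n) = n + 1\<close>, playing the role of \<open>{0 < 1 < \<dots> < n}\<close>; projective subspaces of \<open>\<P>\<^sup>n\<close>
  are represented by the linear subspaces of \<open>K\<^bsup>n+1\<^esup>\<close> which are the cones over them.
\<close>

type_synonym ('n, 'k) mpoly = "('n \<Rightarrow>\<^sub>0 nat) \<Rightarrow>\<^sub>0 'k"

definition mconst :: "'k \<Rightarrow> ('n, 'k::zero) mpoly"
  where "mconst c = Poly_Mapping.single 0 c"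

definition mvar :: "'n \<Rightarrow> ('n, 'k::zero_neq_one) mpoly"
  where "mvar i = Poly_Mapping.single (Poly_Mapping.single i 1) 1"

definition meval :: "'k ^ 'n \<Rightarrow> ('n, 'k) mpoly \<Rightarrow> 'k::comm_semiring_1"
  where "meval x p =
    (\<Sum>m\<in>Poly_Mapping.keys p. Poly_Mapping.lookup p m * (\<Prod>i\<in>UNIV. (x $ i) ^ Poly_Mapping.lookup m i))"

definition mpartial :: "'n \<Rightarrow> ('n, 'k) mpoly \<Rightarrow> ('n, 'k::comm_semiring_1) mpoly"
  where "mpartial i p =
    (\<Sum>m\<in>Poly_Mapping.keys p.
      Poly_Mapping.single (m - Poly_Mapping.single i 1)
        (of_nat (Poly_Mapping.lookup m i) * Poly_Mapping.lookup p m))"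

definition mdegree :: "('n::finite, 'k::zero) mpoly \<Rightarrow> nat"
  where "mdegree p = Max (insert 0 ((\<lambda>m. \<Sum>i\<in>UNIV. Poly_Mapping.lookup m i) ` Poly_Mapping.keys p))"

text \<open>The graded piece \<open>[S]\<^sub>1\<close> is identified with \<open>K\<^bsup>n+1\<^esup>\<close> through the coefficient vector \<open>a\<close>.\<close>

definition linear_form :: "'k ^ 'n \<Rightarrow> ('n::finite, 'k::comm_semiring_1) mpoly"
  where "linear_form a = (\<Sum>i\<in>UNIV. mconst (a $ i) * mvar i)"

text \<open>\<open>\<partial>f/\<partial>\<ell>\<close> for \<open>\<ell> = linear_form a\<close>\<close>

definition form_derivative :: "'k ^ 'n \<Rightarrow> ('n, 'k) mpoly \<Rightarrow> ('n::finite, 'k::comm_semiring_1) mpoly"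
  where "form_derivative a f = (\<Sum>i\<in>UNIV. mconst (a $ i) * mpartial i f)"

definition zariski_open :: "('k::comm_semiring_1 ^ 'n) set \<Rightarrow> bool"
  where "zariski_open U \<longleftrightarrow> (\<exists>F :: ('n, 'k) mpoly set. U = {a. \<exists>p\<in>F. meval a p \<noteq> 0})"

text \<open>
  Ideals of a commutative ring are its submodules: \<open>ring_ideal.subspace I\<close> says that \<open>I\<close> is an
  ideal, and \<open>ring_ideal.span G\<close> is the ideal generated by \<open>G\<close>.
\<close>

global_interpretation ring_ideal: module "(*) :: 'a::comm_ring_1 \<Rightarrow> 'a \<Rightarrow> 'a"
  by unfold_locales (simp_all add: algebra_simps)

definition ideal_radical :: "'a::comm_ring_1 set \<Rightarrow> 'a set"
  where "ideal_radical I = {x. \<exists>k::nat. x ^ k \<in> I}"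

definition primary_ideal :: "'a::comm_ring_1 set \<Rightarrow> bool"
  where "primary_ideal Q \<longleftrightarrow> ring_ideal.subspace Q \<and> Q \<noteq> UNIV \<and>
    (\<forall>x y. x * y \<in> Q \<longrightarrow> x \<in> Q \<or> (\<exists>k::nat. y ^ k \<in> Q))"

text \<open>The empty intersection is the unit ideal.\<close>

definition minimal_primary_decomposition ::
    "'a::comm_ring_1 set \<Rightarrow> 'i set \<Rightarrow> ('i \<Rightarrow> 'a set) \<Rightarrow> bool"
  where "minimal_primary_decomposition I J Q \<longleftrightarrow>
    finite J \<and>
    I = (\<Inter>j\<in>J. Q j) \<and>
    (\<forall>j\<in>J. primary_ideal (Q j)) \<and>
    inj_on (\<lambda>j. ideal_radical (Q j)) J \<and>
    (\<forall>j\<in>J. \<not> (\<Inter>i\<in>J - {j}. Q i) \<subseteq> Q j)"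

text \<open>Each term is a non-zero-divisor modulo the ideal generated by the preceding ones.\<close>

definition weakly_regular_sequence :: "'a::comm_ring_1 list \<Rightarrow> bool"
  where "weakly_regular_sequence fs \<longleftrightarrow>
    (\<forall>i<length fs. \<forall>h. fs ! i * h \<in> ring_ideal.span (set (take i fs)) \<longrightarrow>
       h \<in> ring_ideal.span (set (take i fs)))"

definition regular_sequence :: "'a::comm_ring_1 list \<Rightarrow> bool"
  where "regular_sequence fs \<longleftrightarrow> weakly_regular_sequence fs \<and> ring_ideal.span (set fs) \<noteq> UNIV"

definition hyperplane_of :: "'k ^ 'n \<Rightarrow> ('k::comm_semiring_1 ^ 'n::finite) set"
  where "hyperplane_of a = {x. meval x (linear_form a) = 0}"

definition hyperplane_arrangement :: "('k::comm_semiring_1 ^ 'n::finite) set set \<Rightarrow> bool"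
  where "hyperplane_arrangement A \<longleftrightarrow> finite A \<and> (\<forall>H\<in>A. \<exists>a. a \<noteq> 0 \<and> H = hyperplane_of a)"

text \<open>
  The defining linear form of a hyperplane is only unique up to a non-zero scalar;
  \<open>\<alpha>\<close> fixes a choice of (the coefficient vectors of) defining forms.
\<close>

definition defining_forms ::
    "('k::comm_semiring_1 ^ 'n::finite) set set \<Rightarrow> (('k ^ 'n) set \<Rightarrow> 'k ^ 'n) \<Rightarrow> bool"
  where "defining_forms A \<alpha> \<longleftrightarrow> (\<forall>H\<in>A. \<alpha> H \<noteq> 0 \<and> H = hyperplane_of (\<alpha> H))"

definition arrangement_poly ::
    "('k::comm_semiring_1 ^ 'n::finite) set set \<Rightarrow> (('k ^ 'n) set \<Rightarrow> 'k ^ 'n) \<Rightarrow> ('n, 'k) mpoly"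
  where "arrangement_poly A \<alpha> = (\<Prod>H\<in>A. linear_form (\<alpha> H))"

text \<open>
  \<open>S(\<A>)\<close>. For \<open>n = 1\<close> its only possible element is the zero subspace, i.e. the empty
  subspace of the projective line, whose ideal is \<open>(x\<^sub>0, x\<^sub>1)\<close>.
\<close>

definition codim_two_intersections :: "'v set set \<Rightarrow> 'v set set"
  where "codim_two_intersections A = {H \<inter> H' | H H'. H \<in> A \<and> H' \<in> A \<and> H \<noteq> H'}"

text \<open>
  The polynomials vanishing on a linear subspace \<open>P\<close> of \<open>K\<^bsup>n+1\<^esup>\<close>; over an infinite field this is
  the homogeneous ideal of the corresponding projective subspace.
\<close>

definition subspace_ideal :: "('k::comm_semiring_1 ^ 'n) set \<Rightarrow> ('n, 'k) mpoly set"
  where "subspace_ideal P = {p. \<forall>x\<in>P. meval x p = 0}"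

definition local_poly ::
    "('k::comm_semiring_1 ^ 'n::finite) set set \<Rightarrow> (('k ^ 'n) set \<Rightarrow> 'k ^ 'n) \<Rightarrow> ('k ^ 'n) set
      \<Rightarrow> ('n, 'k) mpoly"
  where "local_poly A \<alpha> P =
    (\<Prod>H\<in>{H\<in>A. linear_form (\<alpha> H) \<in> subspace_ideal P}. linear_form (\<alpha> H))"

definition local_mult ::
    "('k::comm_semiring_1 ^ 'n::finite) set set \<Rightarrow> (('k ^ 'n) set \<Rightarrow> 'k ^ 'n) \<Rightarrow> ('k ^ 'n) set \<Rightarrow> nat"
  where "local_mult A \<alpha> P = mdegree (local_poly A \<alpha> P)"

end

theory Submission
  imports Defs
begin

text \<open>
  Dividing the ideal \<open>(f, f')\<close> by a linear form \<open>l\<close> with \<open>f = l h\<close> gives \<open>(h, l h')\<close>, and repeating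
  this leads to the ideals \<open>(h, q h')\<close> with \<open>q\<close> the product of the forms removed so far. Modulo \<open>l\<close>,
  where \<open>f' = \<partial>l/\<partial>\<ell> h\<close>, membership in \<open>(f, q f')\<close> is divisibility by \<open>q h\<close>, and
  the forms of \<open>q h\<close> become primes that are associated exactly if they cut out the same \<open>P\<close> on \<open>l = 0\<close>.
  Hence \<open>p\<close> in all the local ideals is of the form \<open>z q f' + l r\<close>, where \<open>r\<close> lies in all the local
  ideals with \<open>l\<close> moved from \<open>f\<close> to \<open>q\<close>, and induction on the degree of \<open>f\<close> applies. The same
  induction shows that the local ideals are primary. A direction \<open>\<ell>\<close> is general
  if \<open>\<partial>l/\<partial>\<ell> \<noteq> 0\<close> for all defining forms \<open>l\<close>, that is, if its coefficient
  vector lies on none of the hyperplanes.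
\<close>

text \<open>For the scalar action \<open>(*)\<close> this simp rule is associativity from right to left, which loops
  with \<open>mult.assoc\<close>.\<close>

declare ring_ideal.scale_scale [simp del]

subsection \<open>Polynomials as functions\<close>

text \<open>Reduces identities that are additive in \<open>p\<close> to single terms: an update at a
  fresh exponent vector is the addition of one term.\<close>

lemma mpoly_single_induct [case_names single add]:
  fixes p :: "('n, 'k::comm_semiring_1) mpoly"
  assumes "\<And>m c. P (Poly_Mapping.single m c)"
    and "\<And>p q. P p \<Longrightarrow> P q \<Longrightarrow> P (p + q)"
  shows "P p"
proof (induction p rule: update_induct)
  case const
  show ?case using assms(1)[of 0 0] by simp
next
  case (update p m c)
  have "Poly_Mapping.update m c p = p + Poly_Mapping.single m c"
    using update(1) by (intro poly_mapping_eqI)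
      (auto simp: lookup_update lookup_add lookup_single when_def in_keys_iff)
  then show ?case using update assms by simp
qed

lemma meval_single:
  "meval x (Poly_Mapping.single m c) = c * (\<Prod>i\<in>UNIV. (x $ i) ^ Poly_Mapping.lookup m i)"
  by (cases "c = 0") (simp_all add: meval_def)

lemma meval_add [simp]: "meval x (p + q) = meval x p + meval x q"
  unfolding meval_def
  by (rule setsum_keys_plus_distrib) (simp_all add: algebra_simps)

lemma meval_0 [simp]: "meval x 0 = 0"
  by (simp add: meval_def)

lemma meval_mult [simp]: "meval x (p * q) = meval x p * meval x q"
proof (induction p rule: mpoly_single_induct)
  case (single m c)
  show ?case
  proof (induction q rule: mpoly_single_induct)
    case (single m' c')
    then show ?case
      by (simp add: meval_single mult_single lookup_add power_add prod.distrib algebra_simps)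
  qed (simp add: algebra_simps)
qed (simp add: algebra_simps)

lemma meval_mconst [simp]: "meval x (mconst c) = c"
  by (simp add: mconst_def meval_single)

lemma meval_mvar [simp]: "meval x (mvar i) = x $ i" for x :: "'k::comm_semiring_1 ^ 'n::finite"
proof -
  have "(\<Prod>j\<in>UNIV. (x $ j) ^ Poly_Mapping.lookup (Poly_Mapping.single i 1) j)
      = (\<Prod>j\<in>UNIV. if j = i then x $ i else 1)"
    by (intro prod.cong) (auto simp: lookup_single when_def)
  then show ?thesis by (simp add: mvar_def meval_single)
qed

lemma meval_1 [simp]: "meval x 1 = 1"
  using meval_mconst[of x 1] by (simp add: mconst_def)

lemma meval_sum [simp]: "meval x (\<Sum>i\<in>I. f i) = (\<Sum>i\<in>I. meval x (f i))"
  by (induction I rule: infinite_finite_induct) simp_all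

lemma meval_prod [simp]: "meval x (\<Prod>i\<in>I. f i) = (\<Prod>i\<in>I. meval x (f i))"
  by (induction I rule: infinite_finite_induct) simp_all

lemma meval_power [simp]: "meval x (p ^ k) = meval x p ^ k"
  by (induction k) simp_all

lemma meval_uminus [simp]: "meval x (- p) = - meval x p" for p :: "('n::finite, 'k::comm_ring_1) mpoly"
  by (metis add.right_inverse add_eq_0_iff meval_0 meval_add)

lemma meval_diff [simp]: "meval x (p - q) = meval x p - meval x q"
  for p :: "('n::finite, 'k::comm_ring_1) mpoly"
  using meval_add[of x p "- q"] by simp

lemma meval_linear_form:
  "meval x (linear_form b) = (\<Sum>i\<in>UNIV. b $ i * x $ i)"
  by (simp add: linear_form_def)

section \<open>Polynomials are determined by their values\<close>

text \<open>Artin's argument: subtracting \<open>\<theta> l y\<close> times the relation from its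
  translate by \<open>y\<close> eliminates the term of \<open>l\<close>. The characters in mind are
  the monomials, which are multiplicative for the componentwise product of vectors.\<close>

lemma linear_independent_characters:
  fixes \<theta> :: "'i \<Rightarrow> 'g::times \<Rightarrow> 'k::field"
  assumes "finite M"
    and hom: "\<And>m x y. m \<in> M \<Longrightarrow> \<theta> m (x * y) = \<theta> m x * \<theta> m y"
    and nz: "\<And>m. m \<in> M \<Longrightarrow> \<exists>x. \<theta> m x \<noteq> 0"
    and inj: "inj_on \<theta> M"
    and rel: "\<And>x. (\<Sum>m\<in>M. c m * \<theta> m x) = 0"
    and "m \<in> M"
  shows "c m = 0"
  using assms
proof (induction M arbitrary: c m rule: finite_induct)
  case empty
  then show ?case by simp
next
  case (insert l M)
  have zero: "c m' = 0" if m': "m' \<in> M" for m'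
  proof -
    have "\<theta> m' \<noteq> \<theta> l" using insert.prems(3) insert.hyps that by (metis inj_on_insert insert_iff inj_on_contraD)
    then obtain y where y: "\<theta> m' y \<noteq> \<theta> l y" by blast
    have "(\<Sum>m\<in>M. c m * (\<theta> m y - \<theta> l y) * \<theta> m x) = 0" for x
    proof -
      have "(\<Sum>m\<in>M. c m * (\<theta> m y - \<theta> l y) * \<theta> m x)
          = (\<Sum>m\<in>insert l M. c m * (\<theta> m y - \<theta> l y) * \<theta> m x)"
        using insert.hyps by simp
      also have "\<dots> = (\<Sum>m\<in>insert l M. c m * \<theta> m (y * x)) - \<theta> l y * (\<Sum>m\<in>insert l M. c m * \<theta> m x)"
        unfolding sum_distrib_left sum_subtractf[symmetric]
      proof (intro sum.cong refl)
        fix m assume "m \<in> insert l M"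
        then have eq: "\<theta> m (y * x) = \<theta> m y * \<theta> m x" by (rule insert.prems(1))
        show "c m * (\<theta> m y - \<theta> l y) * \<theta> m x = c m * \<theta> m (y * x) - \<theta> l y * (c m * \<theta> m x)"
          unfolding eq by algebra
      qed
      finally show ?thesis by (simp only: insert.prems(4) mult_zero_right diff_zero)
    qed
    then have "c m' * (\<theta> m' y - \<theta> l y) = 0"
    proof (intro insert.IH[where c = "\<lambda>m. c m * (\<theta> m y - \<theta> l y)"])
      show "inj_on \<theta> M" using insert.prems(3) by simp
    qed (simp_all add: insert.prems m')
    then show ?thesis using y by simp
  qed
  have "c l * \<theta> l x = 0" for x
    using insert.prems(4)[of x] insert.hyps zero by simp
  moreover obtain x where "\<theta> l x \<noteq> 0" using insert.prems(2) by blast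
  ultimately have "c l = 0" by (metis mult_eq_0_iff)
  then show ?case using zero insert.prems(5) by blast
qed

lemma meval_eq_0_imp_eq_0:
  fixes p :: "('n::finite, 'k::field_char_0) mpoly"
  assumes "\<And>x. meval x p = 0"
  shows "p = 0"
proof -
  define \<theta> :: "('n \<Rightarrow>\<^sub>0 nat) \<Rightarrow> ('k ^ 'n) \<Rightarrow> 'k"
    where "\<theta> m x = (\<Prod>i\<in>UNIV. (x $ i) ^ Poly_Mapping.lookup m i)" for m x
  have "\<theta> m \<noteq> \<theta> m'" if "m \<noteq> m'" for m m'
  proof
    assume eq: "\<theta> m = \<theta> m'"
    obtain i where i: "Poly_Mapping.lookup m i \<noteq> Poly_Mapping.lookup m' i"
      using \<open>m \<noteq> m'\<close> by (meson poly_mapping_eqI)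
    \<comment> \<open>The vector with entry 2 at \<open>i\<close> and 1 elsewhere reads off the
      exponent of \<open>i\<close>, because distinct powers of 2 stay distinct in characteristic
      zero.\<close>
    have chi2: "\<theta> m (\<chi> j. if j = i then 2 else 1) = 2 ^ Poly_Mapping.lookup m i" for m
    proof -
      have "\<theta> m (\<chi> j. if j = i then 2 else 1)
          = (\<Prod>j\<in>UNIV. if j = i then 2 ^ Poly_Mapping.lookup m i else 1)"
        unfolding \<theta>_def by (intro prod.cong) auto
      then show ?thesis by simp
    qed
    have "(of_nat (2 ^ Poly_Mapping.lookup m i) :: 'k) = of_nat (2 ^ Poly_Mapping.lookup m' i)"
      using fun_cong[OF eq, of "\<chi> j. if j = i then 2 else 1"] unfolding chi2 by simp
    then show False using i unfolding of_nat_eq_iff by simp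
  qed
  then have inj: "inj_on \<theta> (Poly_Mapping.keys p)"
    by (metis inj_onI)
  have one: "\<theta> m 1 = 1" for m by (simp add: \<theta>_def)
  have "Poly_Mapping.lookup p m = 0" if "m \<in> Poly_Mapping.keys p" for m
  proof (rule linear_independent_characters[where \<theta> = \<theta> and M = "Poly_Mapping.keys p"])
    show "\<theta> m (x * y) = \<theta> m x * \<theta> m y" for m x y
      by (simp add: \<theta>_def power_mult_distrib prod.distrib)
    show "\<exists>x. \<theta> m x \<noteq> 0" for m using one[of m] by (metis zero_neq_one)
    show "(\<Sum>m\<in>Poly_Mapping.keys p. Poly_Mapping.lookup p m * \<theta> m x) = 0" for x
      using assms[of x] by (simp add: meval_def \<theta>_def)
  qed (use inj that in auto)
  then show ?thesis by (intro poly_mapping_eqI) (metis in_keys_iff lookup_zero)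
qed

text \<open>From here on polynomial identities, in particular those for substitutions, can be
  checked pointwise.\<close>

lemma meval_eqI:
  fixes p q :: "('n::finite, 'k::field_char_0) mpoly"
  assumes "\<And>x. meval x p = meval x q"
  shows "p = q"
  using meval_eq_0_imp_eq_0[of "p - q"] assms by simp

lemma mpoly_induct [case_names const var add mult]:
  fixes p :: "('n::finite, 'k::field_char_0) mpoly"
  assumes "\<And>c. P (mconst c)" and "\<And>i. P (mvar i)"
    and add: "\<And>p q. P p \<Longrightarrow> P q \<Longrightarrow> P (p + q)"
    and mult: "\<And>p q. P p \<Longrightarrow> P q \<Longrightarrow> P (p * q)"
  shows "P p"
proof (induction p rule: mpoly_single_induct)
  case (single m c)
  have "P (1 :: ('n, 'k) mpoly)" using assms(1)[of 1] by (simp add: mconst_def)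
  then have pow: "P (mvar i ^ k)" for i k
    by (induction k) (simp_all add: assms)
  have "P (\<Prod>i\<in>I. mvar i ^ Poly_Mapping.lookup m i)" for I
    by (induction I rule: infinite_finite_induct)
      (simp_all add: pow mult \<open>P 1\<close>)
  then have "P (mconst c * (\<Prod>i\<in>UNIV. mvar i ^ Poly_Mapping.lookup m i))"
    by (intro mult assms)
  also have "mconst c * (\<Prod>i\<in>UNIV. mvar i ^ Poly_Mapping.lookup m i) = Poly_Mapping.single m c"
    by (rule meval_eqI) (simp add: meval_single)
  finally show ?case .
qed (rule add)

subsection \<open>Directional derivatives\<close>

lemma mpartial_single:
  "mpartial i (Poly_Mapping.single m c)
    = Poly_Mapping.single (m - Poly_Mapping.single i 1) (of_nat (Poly_Mapping.lookup m i) * c)"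
  by (cases "c = 0") (simp_all add: mpartial_def)

lemma mpartial_add: "mpartial i (p + q) = mpartial i p + mpartial i q"
  unfolding mpartial_def
  by (rule setsum_keys_plus_distrib) (simp_all add: algebra_simps single_add)

lemma mpartial_mult: "mpartial i (p * q) = mpartial i p * q + p * mpartial i q"
proof (induction p rule: mpoly_single_induct)
  case (single m c)
  show ?case
  proof (induction q rule: mpoly_single_induct)
    case (single m' c')
    let ?e = "Poly_Mapping.single i (1::nat)"
    \<comment> \<open>Subtraction of exponents is truncated, so \<open>m'\<close> can be moved out
      of the difference only if \<open>i\<close> occurs in \<open>m\<close>. Otherwise the
      coefficient is 0 and both sides vanish.\<close>
    have *: "Poly_Mapping.single (m + m' - ?e) (of_nat (Poly_Mapping.lookup m i) * c * c')
        = Poly_Mapping.single (m - ?e + m') (of_nat (Poly_Mapping.lookup m i) * c * c')" for m m' c c'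
    proof (cases "Poly_Mapping.lookup m i = 0")
      case False
      then have "m + m' - ?e = m - ?e + m'"
        by (intro poly_mapping_eqI) (auto simp: lookup_add lookup_minus lookup_single when_def)
      then show ?thesis by simp
    qed simp
    have "mpartial i (Poly_Mapping.single m c * Poly_Mapping.single m' c')
        = Poly_Mapping.single (m + m' - ?e) (of_nat (Poly_Mapping.lookup m i) * c * c')
          + Poly_Mapping.single (m' + m - ?e) (of_nat (Poly_Mapping.lookup m' i) * c' * c)"
      by (simp add: mpartial_single mult_single lookup_add single_add[symmetric]
          distrib_right distrib_left ac_simps)
    also have "\<dots> = mpartial i (Poly_Mapping.single m c) * Poly_Mapping.single m' c'
        + Poly_Mapping.single m c * mpartial i (Poly_Mapping.single m' c')"
      unfolding * mpartial_single mult_single by (simp only: ac_simps)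
    finally show ?case .
  qed (simp add: mpartial_add distrib_left add_ac)
qed (simp add: mpartial_add distrib_right add_ac)

lemma form_derivative_mult:
  "form_derivative a (p * q) = form_derivative a p * q + p * form_derivative a q"
  by (simp add: form_derivative_def mpartial_mult algebra_simps sum.distrib sum_distrib_left)

lemma form_derivative_1 [simp]: "form_derivative a 1 = 0"
  by (simp add: form_derivative_def mpartial_def)

lemma mpartial_0 [simp]: "mpartial i 0 = 0"
  by (simp add: mpartial_def)

lemma mpartial_linear_form: "mpartial i (linear_form b) = mconst (b $ i)"
proof -
  have "mpartial i (\<Sum>j\<in>J. mconst (b $ j) * mvar j) = (\<Sum>j\<in>J. mpartial i (mconst (b $ j) * mvar j))" for J
    by (induction J rule: infinite_finite_induct) (simp_all add: mpartial_add)
  then have "mpartial i (linear_form b) = (\<Sum>j\<in>UNIV. mpartial i (mconst (b $ j) * mvar j))"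
    by (simp add: linear_form_def)
  also have "\<dots> = (\<Sum>j\<in>UNIV. if j = i then mconst (b $ i) else 0)"
    by (intro sum.cong refl)
      (auto simp: mconst_def mvar_def mult_single mpartial_single lookup_single when_def)
  finally show ?thesis by simp
qed

lemma form_derivative_linear_form:
  "form_derivative a (linear_form b) = mconst (meval a (linear_form b))"
proof -
  have s: "mconst (\<Sum>i\<in>I. h i) = (\<Sum>i\<in>I. mconst (h i))" for I and h :: "'a \<Rightarrow> 'b"
    by (induction I rule: infinite_finite_induct) (simp_all add: mconst_def single_add)
  show ?thesis
    unfolding form_derivative_def mpartial_linear_form meval_linear_form s
    by (intro sum.cong refl) (simp add: mconst_def mult_single mult.commute)
qed

subsection \<open>Divisibility by linear forms\<close>

lemma meval_linear_form_diff_smult: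
  "meval (x - s *s v) (linear_form b) = meval x (linear_form b) - s * meval v (linear_form b)"
  for x :: "'k::comm_ring_1 ^ 'n::finite"
  unfolding meval_linear_form sum_distrib_left sum_subtractf[symmetric]
  by (intro sum.cong refl) (simp add: right_diff_distrib mult.left_commute)

lemma meval_linear_form_commute: "meval x (linear_form b) = meval b (linear_form x)"
  by (simp add: meval_linear_form mult.commute)

lemma meval_0_linear_form [simp]: "meval 0 (linear_form b) = 0"
  by (simp add: meval_linear_form)

lemma ex_meval_linear_form_neq_0:
  assumes "b \<noteq> (0 :: 'k::comm_semiring_1 ^ 'n::finite)"
  shows "\<exists>v. meval v (linear_form b) \<noteq> 0"
proof -
  obtain i where "b $ i \<noteq> 0" using assms by (auto simp: vec_eq_iff)
  moreover have "meval (axis i 1) (linear_form b) = b $ i"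
    by (simp add: meval_linear_form axis_def if_distrib cong: if_cong)
  ultimately show ?thesis by metis
qed

text \<open>Both sides have codimension one. Instead of counting dimensions, a point of the larger
  side is moved into the smaller one along a vector \<open>v\<close> outside both; the multiple of
  \<open>v\<close> used turns out to be 0.\<close>

lemma hyperplane_subset_imp_eq:
  fixes b c :: "'k::field ^ 'n::finite"
  assumes "hyperplane_of b \<subseteq> hyperplane_of c" and "c \<noteq> 0"
  shows "hyperplane_of b = hyperplane_of c"
proof (rule antisym[OF assms(1)])
  obtain v where v: "meval v (linear_form c) \<noteq> 0"
    using ex_meval_linear_form_neq_0[OF \<open>c \<noteq> 0\<close>] by blast
  then have v': "meval v (linear_form b) \<noteq> 0" using assms(1) by (auto simp: hyperplane_of_def)
  show "hyperplane_of c \<subseteq> hyperplane_of b"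
  proof
    fix x assume x: "x \<in> hyperplane_of c"
    let ?s = "meval x (linear_form b) / meval v (linear_form b)"
    have "x - ?s *s v \<in> hyperplane_of b"
      using v' by (simp add: hyperplane_of_def meval_linear_form_diff_smult)
    then have "x - ?s *s v \<in> hyperplane_of c" using assms(1) by blast
    then have "?s * meval v (linear_form c) = 0"
      using x unfolding hyperplane_of_def mem_Collect_eq meval_linear_form_diff_smult by simp
    then show "x \<in> hyperplane_of b" using v v' by (simp add: hyperplane_of_def)
  qed
qed

text \<open>The preceding argument carried out inside \<open>hyperplane_of b\<close>, where the
  forms of \<open>c\<close> and \<open>d\<close> both cut out codimension one. It lets one
  hyperplane through a codimension two space be exchanged for another.\<close>

lemma hyperplane_inter_exchange:
  fixes b c d :: "'k::field ^ 'n::finite"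
  assumes sub: "hyperplane_of b \<inter> hyperplane_of c \<subseteq> hyperplane_of d"
    and "hyperplane_of d \<noteq> hyperplane_of b" and "d \<noteq> 0"
  shows "hyperplane_of b \<inter> hyperplane_of d = hyperplane_of b \<inter> hyperplane_of c"
proof (intro antisym)
  obtain v where v: "v \<in> hyperplane_of b" "v \<notin> hyperplane_of d"
    using hyperplane_subset_imp_eq[of b d] assms(2,3) by blast
  then have v': "meval v (linear_form c) \<noteq> 0" "meval v (linear_form d) \<noteq> 0"
    using sub by (auto simp: hyperplane_of_def)
  show "hyperplane_of b \<inter> hyperplane_of d \<subseteq> hyperplane_of b \<inter> hyperplane_of c"
  proof
    fix x assume x: "x \<in> hyperplane_of b \<inter> hyperplane_of d"
    let ?s = "meval x (linear_form c) / meval v (linear_form c)"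
    have "x - ?s *s v \<in> hyperplane_of b \<inter> hyperplane_of c"
      using v v' x by (simp add: hyperplane_of_def meval_linear_form_diff_smult)
    then have "x - ?s *s v \<in> hyperplane_of d" using sub by blast
    then have "?s * meval v (linear_form d) = 0"
      using x unfolding hyperplane_of_def Int_iff mem_Collect_eq meval_linear_form_diff_smult by simp
    then have "meval x (linear_form c) = 0" using v' by simp
    then show "x \<in> hyperplane_of b \<inter> hyperplane_of c" using x by (simp add: hyperplane_of_def)
  qed
qed (use sub in auto)

section \<open>Restriction of polynomials to a hyperplane\<close>

definition proj_along :: "'k::field ^ 'n::finite \<Rightarrow> 'k ^ 'n \<Rightarrow> 'k ^ 'n \<Rightarrow> 'k ^ 'n"
  where "proj_along v b x = x - (meval x (linear_form b) / meval v (linear_form b)) *s v"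

text \<open>Pullback along \<open>proj_along v b\<close>, written as a substitution so that the
  result is a polynomial. If \<open>linear_form b\<close> does not vanish at \<open>v\<close>, this
  is a model of the quotient map modulo \<open>linear_form b\<close> with values in the polynomial
  ring itself, so divisibility in the quotient becomes divisibility of polynomials.\<close>

definition restrict_along :: "'k::field ^ 'n::finite \<Rightarrow> 'k ^ 'n \<Rightarrow> ('n, 'k) mpoly \<Rightarrow> ('n, 'k) mpoly"
  where "restrict_along v b p = (\<Sum>m\<in>Poly_Mapping.keys p. mconst (Poly_Mapping.lookup p m) *
    (\<Prod>i\<in>UNIV. (mvar i - mconst (v $ i / meval v (linear_form b)) * linear_form b)
      ^ Poly_Mapping.lookup m i))"

lemma proj_along_in_hyperplane:
  "meval v (linear_form b) \<noteq> 0 \<Longrightarrow> proj_along v b x \<in> hyperplane_of b"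
  by (simp add: proj_along_def hyperplane_of_def meval_linear_form_diff_smult)

lemma proj_along_fixes: "x \<in> hyperplane_of b \<Longrightarrow> proj_along v b x = x"
  by (simp add: proj_along_def hyperplane_of_def)

lemma meval_restrict_along: "meval x (restrict_along v b p) = meval (proj_along v b x) p"
  by (simp add: restrict_along_def proj_along_def meval_def[of _ p] mult.commute)

context
  fixes v b :: "'k::field_char_0 ^ 'n::finite"
begin

lemma restrict_along_add [simp]:
  "restrict_along v b (p + q) = restrict_along v b p + restrict_along v b q"
  by (rule meval_eqI) (simp add: meval_restrict_along)

lemma restrict_along_diff [simp]:
  "restrict_along v b (p - q) = restrict_along v b p - restrict_along v b q"
  by (rule meval_eqI) (simp add: meval_restrict_along)

lemma restrict_along_mult [simp]:
  "restrict_along v b (p * q) = restrict_along v b p * restrict_along v b q"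
  by (rule meval_eqI) (simp add: meval_restrict_along)

lemma restrict_along_power [simp]:
  "restrict_along v b (p ^ k) = restrict_along v b p ^ k"
  by (rule meval_eqI) (simp add: meval_restrict_along)

lemma restrict_along_prod [simp]:
  "restrict_along v b (\<Prod>i\<in>I. h i) = (\<Prod>i\<in>I. restrict_along v b (h i))"
  by (rule meval_eqI) (simp add: meval_restrict_along)

lemma restrict_along_mconst [simp]: "restrict_along v b (mconst c) = mconst c"
  by (rule meval_eqI) (simp add: meval_restrict_along)

text \<open>The substitution changes each variable by a multiple of the form, and congruences modulo
  the form are compatible with sums and products.\<close>

lemma linear_form_dvd_diff_restrict_along: "linear_form b dvd p - restrict_along v b p"
proof (induction p rule: mpoly_induct)
  case (var i)
  have "mvar i - restrict_along v b (mvar i) = linear_form b * mconst (v $ i / meval v (linear_form b))"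
    by (rule meval_eqI) (simp add: meval_restrict_along proj_along_def)
  then show ?case by simp
next
  case (add p q)
  then show ?case by (metis add_diff_add dvd_add restrict_along_add)
next
  case (mult p q)
  have "p * q - restrict_along v b (p * q)
      = (p - restrict_along v b p) * q + restrict_along v b p * (q - restrict_along v b q)"
    by (simp add: algebra_simps)
  then show ?case using mult by (metis dvd_add dvd_mult dvd_mult2)
qed simp

context
  assumes v: "meval v (linear_form b) \<noteq> 0"
begin

lemma restrict_along_idem [simp]:
  "restrict_along v b (restrict_along v b p) = restrict_along v b p"
  by (rule meval_eqI) (simp add: meval_restrict_along proj_along_fixes proj_along_in_hyperplane v)

lemma restrict_along_self [simp]: "restrict_along v b (linear_form b) = 0"
  by (rule meval_eqI)
    (use proj_along_in_hyperplane[OF v] in \<open>simp add: meval_restrict_along hyperplane_of_def\<close>)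

lemma linear_form_dvd_iff_restrict_along_eq_0: "linear_form b dvd p \<longleftrightarrow> restrict_along v b p = 0"
proof
  assume "restrict_along v b p = 0"
  then show "linear_form b dvd p" using linear_form_dvd_diff_restrict_along[of p] by simp
qed auto

lemma restrict_along_linear_form:
  "restrict_along v b (linear_form c)
    = linear_form (c - (meval v (linear_form c) / meval v (linear_form b)) *s b)"
proof (rule meval_eqI)
  fix x
  show "meval x (restrict_along v b (linear_form c))
    = meval x (linear_form (c - (meval v (linear_form c) / meval v (linear_form b)) *s b))"
    unfolding meval_restrict_along proj_along_def meval_linear_form_diff_smult
      meval_linear_form_commute[of x "c - _"]
    by (simp add: meval_linear_form_commute[of x])
qed

end

end

text \<open>Vanishing on the hyperplane means that the restriction is zero at every point, hence
  zero as a polynomial.\<close>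

lemma linear_form_dvd_iff:
  fixes b :: "'k::field_char_0 ^ 'n::finite"
  assumes "b \<noteq> 0"
  shows "linear_form b dvd p \<longleftrightarrow> (\<forall>x\<in>hyperplane_of b. meval x p = 0)"
proof
  assume "linear_form b dvd p"
  then show "\<forall>x\<in>hyperplane_of b. meval x p = 0" by (auto simp: hyperplane_of_def)
next
  assume vanish: "\<forall>x\<in>hyperplane_of b. meval x p = 0"
  obtain v where v: "meval v (linear_form b) \<noteq> 0"
    using ex_meval_linear_form_neq_0[OF assms] by blast
  have "restrict_along v b p = 0"
    by (rule meval_eqI) (use vanish proj_along_in_hyperplane[OF v] in \<open>simp add: meval_restrict_along\<close>)
  then show "linear_form b dvd p" using linear_form_dvd_iff_restrict_along_eq_0[OF v] by blast
qed

lemma linear_form_dvd_linear_form_iff: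
  fixes b c :: "'k::field_char_0 ^ 'n::finite"
  assumes "b \<noteq> 0" "c \<noteq> 0"
  shows "linear_form b dvd linear_form c \<longleftrightarrow> hyperplane_of b = hyperplane_of c"
proof -
  have "linear_form b dvd linear_form c \<longleftrightarrow> hyperplane_of b \<subseteq> hyperplane_of c"
    unfolding linear_form_dvd_iff[OF assms(1)] by (auto simp: hyperplane_of_def)
  then show ?thesis using hyperplane_subset_imp_eq assms by blast
qed

text \<open>The multiples of the form are the kernel of a multiplicative map into an integral
  domain. The order on the variables enters here: it orders the exponent vectors, through which the
  ring is known to have no zero divisors.\<close>

lemma prime_elem_linear_form:
  fixes b :: "'k::field_char_0 ^ 'n::{finite,linorder}"
  assumes "b \<noteq> 0"
  shows "prime_elem (linear_form b)"
proof (rule prime_elemI)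
  obtain v where v: "meval v (linear_form b) \<noteq> 0"
    using ex_meval_linear_form_neq_0[OF assms] by blast
  then show "linear_form b \<noteq> 0" by auto
  show "\<not> linear_form b dvd 1"
  proof
    assume "linear_form b dvd 1"
    then obtain q where "1 = linear_form b * q" ..
    then have "meval 0 (1 :: ('n, 'k) mpoly) = meval 0 (linear_form b * q)" by (rule arg_cong)
    then show False by simp
  qed
  show "linear_form b dvd p \<or> linear_form b dvd q" if "linear_form b dvd p * q" for p q
    using that unfolding linear_form_dvd_iff_restrict_along_eq_0[OF v] by simp
qed

context
  fixes v b c :: "'k::field_char_0 ^ 'n::{finite,linorder}"
  assumes v: "meval v (linear_form b) \<noteq> 0"
    and c: "c \<noteq> 0" and neq: "hyperplane_of b \<noteq> hyperplane_of c"
begin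

lemma restrict_along_linear_form_neq_0: "restrict_along v b (linear_form c) \<noteq> 0"
proof -
  have "b \<noteq> 0" using v by (auto simp: meval_linear_form)
  then show ?thesis
    using linear_form_dvd_iff_restrict_along_eq_0[OF v] linear_form_dvd_linear_form_iff c neq by metis
qed

lemma prime_elem_restrict_along: "prime_elem (restrict_along v b (linear_form c))"
proof -
  \<comment> \<open>The restriction is again a linear form, and its coefficient vector is not 0,
    since the restriction would vanish otherwise.\<close>
  have "linear_form (0 :: ('k, 'n) vec) = 0" by (rule meval_eqI) (simp add: meval_linear_form)
  then show ?thesis
    using restrict_along_linear_form_neq_0 prime_elem_linear_form
    unfolding restrict_along_linear_form[OF v] by metis
qed

text \<open>The hyperplane of the restricted form is the preimage of \<open>hyperplane_of c\<close>
  under the projection, and the projection fixes \<open>hyperplane_of b\<close> pointwise.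
  Consequently restricted forms divide one another according to the intersections they cut out on
  \<open>hyperplane_of b\<close>.\<close>

lemma restrict_along_dvd_iff:
  "restrict_along v b (linear_form c) dvd restrict_along v b p
    \<longleftrightarrow> p \<in> subspace_ideal (hyperplane_of b \<inter> hyperplane_of c)"
proof -
  define d where "d = c - (meval v (linear_form c) / meval v (linear_form b)) *s b"
  have d: "restrict_along v b (linear_form c) = linear_form d"
    unfolding d_def by (rule restrict_along_linear_form[OF v])
  then have "d \<noteq> 0" using restrict_along_linear_form_neq_0 meval_eq_0_imp_eq_0[of "linear_form d"]
    by (auto simp: meval_linear_form)
  have "x \<in> hyperplane_of d \<longleftrightarrow> proj_along v b x \<in> hyperplane_of c" for x
    unfolding hyperplane_of_def d[symmetric] by (simp add: meval_restrict_along)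
  then have "linear_form d dvd restrict_along v b p
      \<longleftrightarrow> (\<forall>x. proj_along v b x \<in> hyperplane_of c \<longrightarrow> meval (proj_along v b x) p = 0)"
    unfolding linear_form_dvd_iff[OF \<open>d \<noteq> 0\<close>] by (simp add: Ball_def meval_restrict_along)
  also have "\<dots> \<longleftrightarrow> p \<in> subspace_ideal (hyperplane_of b \<inter> hyperplane_of c)"
    unfolding subspace_ideal_def mem_Collect_eq
    using proj_along_in_hyperplane[OF v] proj_along_fixes[of _ b v] by (metis IntE IntI)
  finally show ?thesis unfolding d .
qed

end

subsection \<open>Products of prime elements\<close>

text \<open>The primes are stripped off one at a time. They may be associated to each other, as
  happens for the restrictions of forms through the same \<open>P\<close>.\<close>

lemma prod_prime_dvd_mult_cancel:
  fixes a :: "'a::idom"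
  assumes "finite I" and "\<And>i. i \<in> I \<Longrightarrow> prime_elem (p i)" and "\<And>i. i \<in> I \<Longrightarrow> \<not> p i dvd a"
    and "(\<Prod>i\<in>I. p i) dvd a * x"
  shows "(\<Prod>i\<in>I. p i) dvd x"
  using assms
proof (induction I arbitrary: x rule: finite_induct)
  case (insert i I)
  have pi: "prime_elem (p i)" using insert.prems by blast
  have "p i dvd a * x"
    using insert.prems(3) unfolding prod.insert[OF insert.hyps] by (rule dvd_mult_left)
  then have "p i dvd x" using prime_elem_dvd_mult_iff[OF pi] insert.prems(2) by blast
  then obtain z where z: "x = p i * z" ..
  have "p i * (\<Prod>j\<in>I. p j) dvd p i * (a * z)"
    using insert.prems(3) unfolding z prod.insert[OF insert.hyps] by (simp only: mult.left_commute)
  then have "(\<Prod>j\<in>I. p j) dvd a * z" using pi by (simp add: prime_elem_def)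
  then have "(\<Prod>j\<in>I. p j) dvd z"
    using insert.IH insert.prems(1,2) by (meson insertCI)
  then show ?case unfolding z prod.insert[OF insert.hyps] by (intro mult_dvd_mono dvd_refl)
qed simp

lemma prime_elem_dvd_prod:
  assumes "prime_elem p" "p dvd (\<Prod>i\<in>I. h i)"
  shows "\<exists>i\<in>I. p dvd h i"
  using assms
  by (induction I rule: infinite_finite_induct) (auto simp: prime_elem_dvd_mult_iff prime_elem_not_unit)

text \<open>Associated primes lie in one class of \<open>\<kappa>\<close>, so the products over
  different classes are coprime. The induction removes a whole class at a time.\<close>

lemma prod_prime_dvd_if_classes_dvd:
  fixes x :: "'a::idom"
  assumes "finite I" and prime: "\<And>i. i \<in> I \<Longrightarrow> prime_elem (p i)"
    and classes: "\<And>i j. i \<in> I \<Longrightarrow> j \<in> I \<Longrightarrow> p i dvd p j \<Longrightarrow> \<kappa> i = \<kappa> j"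
    and dvd: "\<And>i. i \<in> I \<Longrightarrow> (\<Prod>j\<in>{j\<in>I. \<kappa> j = \<kappa> i}. p j) dvd x"
  shows "(\<Prod>i\<in>I. p i) dvd x"
  using assms
proof (induction I rule: finite_psubset_induct)
  case (psubset I)
  show ?case
  proof (cases "I = {}")
    case False
    then obtain i where i: "i \<in> I" by blast
    let ?C = "{j\<in>I. \<kappa> j = \<kappa> i}" and ?R = "{j\<in>I. \<kappa> j \<noteq> \<kappa> i}"
    obtain y where y: "x = (\<Prod>j\<in>?C. p j) * y" using psubset.prems(3)[OF i] ..
    have "(\<Prod>j\<in>?R. p j) dvd x"
    proof (rule psubset.IH)
      show "?R \<subset> I" using i by blast
    next
      fix j assume j: "j \<in> ?R"
      then have "{k\<in>?R. \<kappa> k = \<kappa> j} = {k\<in>I. \<kappa> k = \<kappa> j}" by auto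
      then show "(\<Prod>k\<in>{k\<in>?R. \<kappa> k = \<kappa> j}. p k) dvd x" using psubset.prems(3) j by simp
    next
      fix j k assume "j \<in> ?R" "k \<in> ?R" "p j dvd p k"
      then show "\<kappa> j = \<kappa> k" using psubset.prems(2) by blast
    qed (use psubset.prems(1) in blast)
    moreover have "\<not> p j dvd (\<Prod>j\<in>?C. p j)" if "j \<in> ?R" for j
    proof
      assume "p j dvd (\<Prod>j\<in>?C. p j)"
      moreover have "prime_elem (p j)" using that psubset.prems(1) by blast
      ultimately obtain k where "k \<in> ?C" "p j dvd p k" using prime_elem_dvd_prod by blast
      then show False using that psubset.prems(2)[of j k] by simp
    qed
    ultimately have "(\<Prod>j\<in>?R. p j) dvd y"
      unfolding y using psubset.prems(1) psubset.hyps
      by (intro prod_prime_dvd_mult_cancel[of ?R p "\<Prod>j\<in>?C. p j" y]) simp_all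
    moreover have "(\<Prod>j\<in>I. p j) = (\<Prod>j\<in>?C. p j) * (\<Prod>j\<in>?R. p j)"
    proof -
      have "I = ?C \<union> ?R" by blast
      moreover have "prod p (?C \<union> ?R) = prod p ?C * prod p ?R"
        using psubset.hyps by (intro prod.union_disjoint) auto
      ultimately show ?thesis by simp
    qed
    ultimately show ?thesis unfolding y by (simp only: mult_dvd_mono dvd_refl)
  qed simp
qed

subsection \<open>Intersections of hyperplanes\<close>

lemma span_pair_iff:
  "p \<in> ring_ideal.span {g, h} \<longleftrightarrow> (\<exists>x y. p = x * g + y * h)" for g h :: "'a::comm_ring_1"
proof -
  have "p \<in> ring_ideal.span {g, h} \<longleftrightarrow> (\<exists>x y. p - x * g = y * h)"
    by (auto simp: ring_ideal.span_insert ring_ideal.span_singleton)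
  then show ?thesis by (auto simp: algebra_simps)
qed

text \<open>The computations behind division by a form \<open>l\<close>: here \<open>l * b\<close>
  stands for \<open>forms_prod B\<close>, \<open>c\<close> for \<open>forms_prod C\<close>,
  \<open>u\<close> and \<open>d\<close> for the derivatives of \<open>l\<close> and
  \<open>b\<close>, so that \<open>u * b + l * d\<close> is the derivative of
  \<open>l * b\<close>.\<close>

lemma linear_combination_identities:
  fixes l :: "'a::comm_ring_1"
  shows "l * p = x * (l * b) + y * (c * (u * b + l * d))
      \<Longrightarrow> l * (p - x * b - y * (c * d)) = u * (y * (c * b))"
    and "x * (l * b) + l * z * (c * (u * b + l * d)) = l * ((x + z * c * u) * b + z * (l * c * d))"
    and "l * (x * b + y * (l * c * d)) = (x - y * c * u) * (l * b) + l * y * (c * (u * b + l * d))"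
proof -
  have *: "l * (p - x * b - y * (c * d)) = l * p - (x * (l * b) + y * (c * (l * d)))"
    by (simp add: algebra_simps)
  have "x * (l * b) + y * (c * (u * b + l * d)) - (x * (l * b) + y * (c * (l * d))) = u * (y * (c * b))"
    by (simp add: algebra_simps)
  then show "l * (p - x * b - y * (c * d)) = u * (y * (c * b))"
    if "l * p = x * (l * b) + y * (c * (u * b + l * d))"
    unfolding * that .
qed (simp_all add: algebra_simps)

section \<open>Arrangements with a choice of defining forms\<close>

locale hyperplane_forms =
  fixes A :: "('k::field_char_0, 'n::{finite,linorder}) vec set set"
    and \<alpha> :: "('k, 'n) vec set \<Rightarrow> ('k, 'n) vec"
  assumes finite_A: "finite A" and forms: "defining_forms A \<alpha>"
begin

abbreviation lf :: "('k, 'n) vec set \<Rightarrow> ('n, 'k) mpoly"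
  where "lf H \<equiv> linear_form (\<alpha> H)"

lemma \<alpha>_neq_0: "H \<in> A \<Longrightarrow> \<alpha> H \<noteq> 0"
  using forms by (simp add: defining_forms_def)

lemma hyperplane_of_\<alpha>: "H \<in> A \<Longrightarrow> hyperplane_of (\<alpha> H) = H"
  using forms by (simp add: defining_forms_def)

lemma mem_iff_meval_lf: "H \<in> A \<Longrightarrow> x \<in> H \<longleftrightarrow> meval x (lf H) = 0"
  using hyperplane_of_\<alpha> by (auto simp: hyperplane_of_def)

lemma prime_lf: "H \<in> A \<Longrightarrow> prime_elem (lf H)"
  by (simp add: prime_elem_linear_form \<alpha>_neq_0)

lemma lf_dvd_lf_iff: "H \<in> A \<Longrightarrow> M \<in> A \<Longrightarrow> lf H dvd lf M \<longleftrightarrow> H = M"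
  using linear_form_dvd_linear_form_iff[of "\<alpha> H" "\<alpha> M"] by (simp add: \<alpha>_neq_0 hyperplane_of_\<alpha>)

definition forms_prod :: "('k, 'n) vec set set \<Rightarrow> ('n, 'k) mpoly"
  where "forms_prod B = (\<Prod>H\<in>B. lf H)"

text \<open>The localisation of the arrangement at \<open>P\<close>; its product of forms is
  \<open>g_P\<close> and its cardinality is \<open>t_P\<close>.\<close>

definition star :: "('k, 'n) vec set \<Rightarrow> ('k, 'n) vec set set"
  where "star P = {H\<in>A. P \<subseteq> H}"

lemma star_subset: "star P \<subseteq> A"
  by (auto simp: star_def)

lemma forms_prod_empty [simp]: "forms_prod {} = 1"
  by (simp add: forms_prod_def)

lemma forms_prod_remove:
  "finite B \<Longrightarrow> L \<in> B \<Longrightarrow> forms_prod B = lf L * forms_prod (B - {L})"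
  by (simp add: forms_prod_def prod.remove)

lemma forms_prod_Un_disjoint:
  "finite B \<Longrightarrow> finite C \<Longrightarrow> B \<inter> C = {} \<Longrightarrow> forms_prod (B \<union> C) = forms_prod B * forms_prod C"
  by (simp add: forms_prod_def prod.union_disjoint)

lemma lf_dvd_forms_prod_iff:
  assumes "H \<in> A" "B \<subseteq> A"
  shows "lf H dvd forms_prod B \<longleftrightarrow> H \<in> B"
proof
  assume "lf H dvd forms_prod B"
  then show "H \<in> B"
    using prime_elem_dvd_prod[OF prime_lf[OF assms(1)], of lf B] lf_dvd_lf_iff assms
    unfolding forms_prod_def by blast
next
  assume "H \<in> B"
  then show "lf H dvd forms_prod B"
    using assms finite_A finite_subset forms_prod_remove by (metis dvd_triv_left)
qed

lemma forms_prod_neq_0: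
  assumes "B \<subseteq> A"
  shows "forms_prod B \<noteq> 0"
proof -
  have "lf H \<noteq> 0" if "H \<in> B" for H
    using prime_lf[of H] that assms unfolding prime_elem_def by blast
  then show ?thesis
    using finite_subset[OF assms finite_A] unfolding forms_prod_def by (subst prod_zero_iff) auto
qed

lemma star_eq: "star P = {H\<in>A. lf H \<in> subspace_ideal P}"
  unfolding star_def subspace_ideal_def using mem_iff_meval_lf by blast

lemma local_poly_eq: "local_poly A \<alpha> P = forms_prod (star P)"
  by (simp add: local_poly_def forms_prod_def star_eq)

lemma arrangement_poly_eq: "arrangement_poly A \<alpha> = forms_prod A"
  by (simp add: arrangement_poly_def forms_prod_def)

text \<open>At most two exchanges turn the pair \<open>H1\<close>, \<open>H2\<close> defining
  \<open>P\<close> into the pair \<open>H\<close>, \<open>M\<close>.\<close>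

lemma inter_eq_if_subset_star:
  assumes P: "P \<in> codim_two_intersections A" and H: "H \<in> star P" and M: "M \<in> star P" and "H \<noteq> M"
  shows "H \<inter> M = P"
proof -
  have exch: "H \<inter> N = H \<inter> M" if "H \<in> A" "M \<in> A" "N \<in> A" "H \<inter> M \<subseteq> N" "N \<noteq> H" for H M N
    using hyperplane_inter_exchange[of "\<alpha> H" "\<alpha> M" "\<alpha> N"] that
    by (simp add: hyperplane_of_\<alpha> \<alpha>_neq_0)
  obtain H1 H2 where P12: "P = H1 \<inter> H2" "H1 \<in> A" "H2 \<in> A" "H1 \<noteq> H2"
    using P by (auto simp: codim_two_intersections_def)
  have HM: "H \<in> A" "M \<in> A" "P \<subseteq> H" "P \<subseteq> M" using H M by (auto simp: star_def)
  show ?thesis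
  proof (cases "H = H1")
    case True
    then show ?thesis using exch[of H1 H2 M] P12 HM \<open>H \<noteq> M\<close> by simp
  next
    case False
    then have "H1 \<inter> H = P" using exch[of H1 H2 H] P12 HM by simp
    then show ?thesis using exch[of H H1 M] P12 HM \<open>H \<noteq> M\<close> by (simp add: Int_commute)
  qed
qed

lemma inter_mem: "H \<in> A \<Longrightarrow> M \<in> A \<Longrightarrow> H \<noteq> M \<Longrightarrow> H \<inter> M \<in> codim_two_intersections A"
  by (auto simp: codim_two_intersections_def)

lemma codim_two_intersectionsE:
  assumes "P \<in> codim_two_intersections A"
  obtains H M where "H \<in> star P" "M \<in> star P" "H \<noteq> M" "P = H \<inter> M"
  using assms by (auto simp: codim_two_intersections_def star_def)

lemma zero_mem: "P \<in> codim_two_intersections A \<Longrightarrow> 0 \<in> P"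
  by (auto simp: codim_two_intersections_def mem_iff_meval_lf)

lemma finite_codim_two_intersections: "finite (codim_two_intersections A)"
proof -
  have "codim_two_intersections A \<subseteq> (\<lambda>(H, M). H \<inter> M) ` (A \<times> A)"
    by (auto simp: codim_two_intersections_def)
  then show ?thesis using finite_A finite_subset by blast
qed

text \<open>Two hyperplanes through \<open>P'\<close> also contain \<open>P\<close> and therefore
  already cut out \<open>P\<close>. This makes all components of the decomposition isolated.\<close>

lemma inter_inj:
  assumes "P \<in> codim_two_intersections A" "P' \<in> codim_two_intersections A" "P \<subseteq> P'"
  shows "P = P'"
proof -
  obtain H M where "H \<in> star P'" "M \<in> star P'" "H \<noteq> M" "P' = H \<inter> M"
    using assms(2) by (rule codim_two_intersectionsE)
  then show ?thesis
    using inter_eq_if_subset_star[OF assms(1), of H M] assms(3) by (auto simp: star_def)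
qed

end

section \<open>Dividing the ideals \<open>Q B C\<close> by a linear form\<close>

locale generic_derivative = hyperplane_forms +
  fixes a :: "('a::field_char_0, 'b::{finite,linorder}) vec"
  assumes generic: "a \<notin> \<Union>A"
begin

abbreviation D :: "('b, 'a) mpoly \<Rightarrow> ('b, 'a) mpoly"
  where "D \<equiv> form_derivative a"

text \<open>
  The ideals \<open>Q B {}\<close> are those of the theorem. Dividing \<open>Q B C\<close> by a form in \<open>B\<close> yields the
  ideal in which this form has been moved to \<open>C\<close>, which is why the second parameter is needed.
\<close>

definition Q :: "('a, 'b) vec set set \<Rightarrow> ('a, 'b) vec set set \<Rightarrow> ('b, 'a) mpoly set"
  where "Q B C = ring_ideal.span {forms_prod B, forms_prod C * D (forms_prod B)}"

text \<open>Genericity says that no form of the arrangement vanishes at \<open>a\<close>, so the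
  coefficient vector of the general form doubles as the direction of projection onto every
  hyperplane.\<close>

abbreviation \<rho> :: "('a, 'b) vec set \<Rightarrow> ('b, 'a) mpoly \<Rightarrow> ('b, 'a) mpoly"
  where "\<rho> L \<equiv> restrict_along a (\<alpha> L)"

lemma meval_generic: "H \<in> A \<Longrightarrow> meval a (lf H) \<noteq> 0"
  using generic mem_iff_meval_lf by blast

lemma Q_iff: "p \<in> Q B C \<longleftrightarrow> (\<exists>x y. p = x * forms_prod B + y * (forms_prod C * D (forms_prod B)))"
  by (simp add: Q_def span_pair_iff)

lemma subspace_Q: "ring_ideal.subspace (Q B C)"
  by (simp add: Q_def)

lemma Q_add: "p \<in> Q B C \<Longrightarrow> q \<in> Q B C \<Longrightarrow> p + q \<in> Q B C"
  by (simp add: Q_def ring_ideal.span_add)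

lemma Q_diff: "p \<in> Q B C \<Longrightarrow> q \<in> Q B C \<Longrightarrow> p - q \<in> Q B C"
  by (simp add: Q_def ring_ideal.span_diff)

lemma Q_mult: "p \<in> Q B C \<Longrightarrow> q * p \<in> Q B C"
  by (simp add: Q_def ring_ideal.span_scale)

lemma Q_generators: "forms_prod B \<in> Q B C" "forms_prod C * D (forms_prod B) \<in> Q B C"
  by (simp_all add: Q_def ring_ideal.span_base)

text \<open>The empty product is 1, so the ideal is the unit ideal; this is the base case of the
  inductions on \<open>card B\<close>.\<close>

lemma Q_empty [simp]: "p \<in> Q {} C"
  using Q_mult[OF Q_generators(1)[of "{}" C], of p] by simp

lemma D_forms_prod:
  assumes "finite B" "L \<in> B"
  shows "D (forms_prod B)
    = mconst (meval a (lf L)) * forms_prod (B - {L}) + lf L * D (forms_prod (B - {L}))"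
  using forms_prod_remove[OF assms] by (simp add: form_derivative_mult form_derivative_linear_form)

lemma \<rho>_lf: "L \<in> A \<Longrightarrow> \<rho> L (lf L) = 0"
  by (simp add: meval_generic)

lemma lf_dvd_iff_\<rho>: "L \<in> A \<Longrightarrow> lf L dvd p \<longleftrightarrow> \<rho> L p = 0"
  using linear_form_dvd_iff_restrict_along_eq_0 meval_generic by blast

lemma prime_\<rho>:
  "L \<in> A \<Longrightarrow> M \<in> A \<Longrightarrow> L \<noteq> M \<Longrightarrow> prime_elem (\<rho> L (lf M))"
  using prime_elem_restrict_along[of a "\<alpha> L" "\<alpha> M"]
  by (simp add: meval_generic \<alpha>_neq_0 hyperplane_of_\<alpha>)

lemma \<rho>_dvd_iff:
  "L \<in> A \<Longrightarrow> M \<in> A \<Longrightarrow> L \<noteq> M \<Longrightarrow> \<rho> L (lf M) dvd \<rho> L p \<longleftrightarrow> p \<in> subspace_ideal (L \<inter> M)"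
  using restrict_along_dvd_iff[of a "\<alpha> L" "\<alpha> M"]
  by (simp add: meval_generic \<alpha>_neq_0 hyperplane_of_\<alpha>)

lemma \<rho>_forms_prod: "\<rho> L (forms_prod B) = (\<Prod>H\<in>B. \<rho> L (lf H))"
  by (simp add: forms_prod_def)

context
  fixes B C L
  assumes sub: "B \<union> C \<subseteq> A" and disj: "B \<inter> C = {}" and L: "L \<in> B"
begin

lemma finite_B_C: "finite B" "finite C"
  using sub finite_A finite_subset by (metis Un_subset_iff)+

lemma L_mem: "L \<in> A"
  using sub L by blast

text \<open>This is the constant \<open>D (lf L)\<close>, a unit by genericity; \<open>w\<close> is
  its inverse.\<close>

definition u :: "('b, 'a) mpoly" where "u = mconst (meval a (lf L))"
definition w :: "('b, 'a) mpoly" where "w = mconst (inverse (meval a (lf L)))"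

lemma w_u: "w * u = 1"
  by (rule meval_eqI) (simp add: w_def u_def meval_generic L_mem)

lemma \<rho>_u: "\<rho> L u = u" and \<rho>_w: "\<rho> L w = w"
  by (simp_all add: u_def w_def)

lemma D_split: "D (forms_prod B) = u * forms_prod (B - {L}) + lf L * D (forms_prod (B - {L}))"
  unfolding u_def by (rule D_forms_prod[OF finite_B_C(1) L])

lemma F_split: "forms_prod B = lf L * forms_prod (B - {L})"
  by (rule forms_prod_remove[OF finite_B_C(1) L])

lemma forms_prod_insert_L: "forms_prod (insert L C) = lf L * forms_prod C"
proof -
  have "insert L C - {L} = C" using disj L by blast
  then show ?thesis using forms_prod_remove[of "insert L C" L] finite_B_C by simp
qed

text \<open>Modulo \<open>lf L\<close> only the summand in which the derivative falls on
  \<open>lf L\<close> survives.\<close>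

lemma \<rho>_second_generator:
  "\<rho> L (forms_prod C * D (forms_prod B)) = u * \<rho> L (forms_prod (B \<union> C - {L}))"
proof -
  have "B \<union> C - {L} = (B - {L}) \<union> C" using disj L by blast
  then have eq: "forms_prod (B \<union> C - {L}) = forms_prod (B - {L}) * forms_prod C"
    using forms_prod_Un_disjoint[of "B - {L}" C] finite_B_C disj by auto
  have "\<rho> L (forms_prod C * D (forms_prod B))
      = \<rho> L (forms_prod C) * (\<rho> L u * \<rho> L (forms_prod (B - {L}))
        + \<rho> L (lf L) * \<rho> L (D (forms_prod (B - {L}))))"
    unfolding D_split by (simp only: restrict_along_mult restrict_along_add)
  then show ?thesis
    unfolding eq \<rho>_u \<rho>_lf[OF L_mem] restrict_along_mult by (simp only: mult_zero_left add_0_right mult_ac)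
qed

text \<open>Computes the quotient of \<open>Q B C\<close> by \<open>lf L\<close>. If
  \<open>lf L\<close> divides a combination of the generators, it divides the coefficient
  \<open>y\<close> of the second one, since it is prime and divides neither
  \<open>forms_prod C\<close> nor \<open>forms_prod (B - {L})\<close>.\<close>

lemma lf_mult_in_Q_iff: "lf L * p \<in> Q B C \<longleftrightarrow> p \<in> Q (B - {L}) (insert L C)"
proof
  assume "lf L * p \<in> Q B C"
  then obtain x y where xy: "lf L * p = x * forms_prod B + y * (forms_prod C * D (forms_prod B))"
    unfolding Q_iff by blast
  have "lf L * (p - x * forms_prod (B - {L}) - y * (forms_prod C * D (forms_prod (B - {L}))))
      = u * (y * (forms_prod C * forms_prod (B - {L})))"
    using xy unfolding D_split unfolding F_split by (rule linear_combination_identities(1))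
  then have "lf L dvd w * (u * (y * (forms_prod C * forms_prod (B - {L}))))"
    by (metis dvd_mult dvd_triv_left)
  then have "lf L dvd y * (forms_prod C * forms_prod (B - {L}))"
    unfolding mult.assoc[symmetric] w_u mult_1_left .
  moreover have "C \<subseteq> A" "L \<notin> C" "B - {L} \<subseteq> A" using sub disj L by blast+
  then have "\<not> lf L dvd forms_prod C" "\<not> lf L dvd forms_prod (B - {L})"
    by (simp_all add: lf_dvd_forms_prod_iff[OF L_mem])
  ultimately have "lf L dvd y"
    unfolding prime_elem_dvd_mult_iff[OF prime_lf[OF L_mem]] by blast
  then obtain z where z: "y = lf L * z" ..
  have "lf L * p = lf L * ((x + z * forms_prod C * u) * forms_prod (B - {L})
      + z * (lf L * forms_prod C * D (forms_prod (B - {L}))))"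
    unfolding xy z D_split unfolding F_split by (rule linear_combination_identities(2))
  then have "p = (x + z * forms_prod C * u) * forms_prod (B - {L})
      + z * (lf L * forms_prod C * D (forms_prod (B - {L})))"
    using prime_lf[OF L_mem] mult_left_cancel unfolding prime_elem_def by blast
  then show "p \<in> Q (B - {L}) (insert L C)"
    unfolding Q_iff forms_prod_insert_L by blast
next
  assume "p \<in> Q (B - {L}) (insert L C)"
  then obtain x y where
    p: "p = x * forms_prod (B - {L}) + y * (lf L * forms_prod C * D (forms_prod (B - {L})))"
    unfolding Q_iff forms_prod_insert_L by blast
  have "lf L * p = (x - y * forms_prod C * u) * forms_prod B
      + lf L * y * (forms_prod C * D (forms_prod B))"
    unfolding p D_split unfolding F_split by (rule linear_combination_identities(3))
  then show "lf L * p \<in> Q B C" unfolding Q_iff by blast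
qed

text \<open>The first generator vanishes modulo \<open>lf L\<close>, and the second becomes a unit
  times the displayed product.\<close>

lemma \<rho>_dvd_if_in_Q:
  assumes "p \<in> Q B C"
  shows "\<rho> L (forms_prod (B \<union> C - {L})) dvd \<rho> L p"
proof -
  obtain x y where p: "p = x * forms_prod B + y * (forms_prod C * D (forms_prod B))"
    using assms unfolding Q_iff by blast
  have "\<rho> L p = \<rho> L y * (u * \<rho> L (forms_prod (B \<union> C - {L})))"
    unfolding p restrict_along_add restrict_along_mult[of _ _ y]
    unfolding \<rho>_second_generator
    unfolding F_split restrict_along_mult \<rho>_lf[OF L_mem] by simp
  then show ?thesis by (metis dvd_mult dvd_refl)
qed

text \<open>Conversely, divisibility modulo \<open>lf L\<close> allows a multiple of the second
  generator to be subtracted so that the rest is divisible by \<open>lf L\<close>.\<close>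

lemma Q_division:
  assumes "\<rho> L (forms_prod (B \<union> C - {L})) dvd \<rho> L p"
  obtains z q where "p = z * (forms_prod C * D (forms_prod B)) + lf L * q"
proof -
  obtain r where r: "\<rho> L p = \<rho> L (forms_prod (B \<union> C - {L})) * r" using assms ..
  let ?G = "forms_prod C * D (forms_prod B)"
  \<comment> \<open>The cofactor \<open>r\<close> need not be a restriction; restricting once more
    replaces it by \<open>\<rho> L r\<close>.\<close>
  have "\<rho> L p = \<rho> L (\<rho> L p)" using meval_generic[OF L_mem] by simp
  also have "\<dots> = \<rho> L (forms_prod (B \<union> C - {L})) * \<rho> L r"
    unfolding r using meval_generic[OF L_mem] by simp
  also have "\<dots> = w * u * (\<rho> L (forms_prod (B \<union> C - {L})) * \<rho> L r)"
    by (simp only: w_u mult_1_left)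
  also have "\<dots> = w * \<rho> L r * (u * \<rho> L (forms_prod (B \<union> C - {L})))"
    by (simp only: mult_ac)
  also have "\<dots> = \<rho> L (w * r * ?G)"
    unfolding restrict_along_mult[of _ _ _ ?G] \<rho>_second_generator
    unfolding restrict_along_mult \<rho>_w ..
  finally have "\<rho> L (p - w * r * ?G) = 0" unfolding restrict_along_diff by (rule iffD2[OF right_minus_eq])
  then have "lf L dvd p - w * r * ?G" using lf_dvd_iff_\<rho>[OF L_mem] by blast
  then obtain q where "p - w * r * ?G = lf L * q" ..
  then have "p = w * r * ?G + lf L * q" by (metis add.commute diff_add_cancel)
  then show ?thesis by (rule that)
qed

end

section \<open>Local ideals and the passage back to the global one\<close>

text \<open>Both follow by splitting the products along \<open>S\<close>, the second by the product
  rule. With \<open>S = star P\<close> this gives the easy inclusion of the decomposition.\<close>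

lemma generators_in_local_Q:
  assumes "B \<union> C \<subseteq> A" "B \<inter> C = {}"
  shows "forms_prod B \<in> Q (B \<inter> S) (C \<inter> S)"
    and "forms_prod C * D (forms_prod B) \<in> Q (B \<inter> S) (C \<inter> S)"
proof -
  have fin: "finite B" "finite C" using assms(1) finite_A finite_subset by (metis Un_subset_iff)+
  have split: "forms_prod X = forms_prod (X - S) * forms_prod (X \<inter> S)" if "finite X" for X
  proof -
    have "X = (X - S) \<union> (X \<inter> S)" "(X - S) \<inter> (X \<inter> S) = {}" by blast+
    then show ?thesis using forms_prod_Un_disjoint[of "X - S" "X \<inter> S"] that by simp
  qed
  show "forms_prod B \<in> Q (B \<inter> S) (C \<inter> S)"
    unfolding split[OF fin(1)] by (intro Q_mult Q_generators)
  have "forms_prod C * D (forms_prod B)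
      = forms_prod C * D (forms_prod (B - S)) * forms_prod (B \<inter> S)
        + forms_prod (C - S) * forms_prod (B - S) * (forms_prod (C \<inter> S) * D (forms_prod (B \<inter> S)))"
    unfolding split[OF fin(1)] split[OF fin(2)] form_derivative_mult by (simp add: algebra_simps)
  then show "forms_prod C * D (forms_prod B) \<in> Q (B \<inter> S) (C \<inter> S)"
    by (simp only: Q_add Q_mult Q_generators)
qed

text \<open>Every other hyperplane through \<open>P\<close> cuts out \<open>P\<close> on
  \<open>L\<close>, so none of the restricted primes divides the restriction of
  \<open>q\<close>.\<close>

lemma prod_star_dvd:
  assumes P: "P \<in> codim_two_intersections A" and L: "L \<in> star P" and q: "q \<notin> subspace_ideal P"
    and dvd: "\<rho> L (forms_prod (star P - {L})) dvd \<rho> L (q * p)"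
  shows "\<rho> L (forms_prod (star P - {L})) dvd \<rho> L p"
  using dvd unfolding \<rho>_forms_prod restrict_along_mult
proof (rule prod_prime_dvd_mult_cancel[rotated -1])
  show "finite (star P - {L})" using finite_A star_subset finite_subset by blast
  fix M assume M: "M \<in> star P - {L}"
  then have *: "L \<in> A" "M \<in> A" "L \<noteq> M" "L \<inter> M = P"
    using L star_subset inter_eq_if_subset_star[OF P L, of M] by blast+
  show "prime_elem (\<rho> L (lf M))" using * by (intro prime_\<rho>)
  show "\<not> \<rho> L (lf M) dvd \<rho> L q" using \<rho>_dvd_iff[of L M q] * q by simp
qed

text \<open>Elements outside the prime ideal of \<open>P\<close> are non-zero-divisors modulo the
  local ideals. After \<open>Q_division\<close> the claim for \<open>p\<close> becomes the claim for
  \<open>r\<close>, with \<open>L\<close> moved from \<open>B\<close> to \<open>C\<close>.\<close>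

lemma local_cancel:
  assumes P: "P \<in> codim_two_intersections A" and q: "q \<notin> subspace_ideal P"
    and "B \<union> C = star P" "B \<inter> C = {}" "q * p \<in> Q B C"
  shows "p \<in> Q B C"
  using assms(3-5)
proof (induction "card B" arbitrary: B C p)
  case 0
  then have "B = {}" using finite_subset[OF star_subset finite_A] by (metis card_0_eq finite_Un)
  then show ?case by simp
next
  case (Suc n)
  then obtain L where L: "L \<in> B" by fastforce
  have sub: "B \<union> C \<subseteq> A" using Suc.prems(1) star_subset by simp
  have "L \<in> star P" using L Suc.prems(1) by blast
  then have "\<rho> L (forms_prod (B \<union> C - {L})) dvd \<rho> L p"
    using \<rho>_dvd_if_in_Q[OF sub Suc.prems(2) L Suc.prems(3)] unfolding Suc.prems(1)
    by (rule prod_star_dvd[OF P _ q])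
  then obtain z r where p: "p = z * (forms_prod C * D (forms_prod B)) + lf L * r"
    using Q_division[OF sub Suc.prems(2) L] by blast
  have zQ: "z * (forms_prod C * D (forms_prod B)) \<in> Q B C"
    by (intro Q_mult Q_generators)
  have "lf L * (q * r) = q * p - q * (z * (forms_prod C * D (forms_prod B)))"
    unfolding p by (simp add: algebra_simps)
  also have "\<dots> \<in> Q B C" using Suc.prems(3) Q_mult[OF zQ] by (rule Q_diff)
  finally have "q * r \<in> Q (B - {L}) (insert L C)"
    using lf_mult_in_Q_iff[OF sub Suc.prems(2) L] by blast
  moreover have "n = card (B - {L})" using Suc.hyps(2) L by simp
  moreover have "(B - {L}) \<union> insert L C = star P" "(B - {L}) \<inter> insert L C = {}"
    using Suc.prems(1,2) L by blast+
  ultimately have "r \<in> Q (B - {L}) (insert L C)" using Suc.hyps(1) by blast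
  then have "lf L * r \<in> Q B C" using lf_mult_in_Q_iff[OF sub Suc.prems(2) L] by blast
  then show ?case unfolding p using zQ by (intro Q_add)
qed

text \<open>A suitable power of \<open>q\<close> is congruent to \<open>lf L * r\<close> modulo the
  second generator; multiplying by a power of \<open>q\<close> in the ideal with \<open>L\<close>
  moved brings the product into \<open>Q B C\<close>.\<close>

lemma local_power:
  assumes P: "P \<in> codim_two_intersections A" and q: "q \<in> subspace_ideal P"
    and "B \<union> C = star P" "B \<inter> C = {}"
  shows "\<exists>k. q ^ k \<in> Q B C"
  using assms(3,4)
proof (induction "card B" arbitrary: B C)
  case 0
  then have "B = {}" using finite_subset[OF star_subset finite_A] by (metis card_0_eq finite_Un)
  then show ?case by simp
next
  case (Suc n)
  then obtain L where L: "L \<in> B" by fastforce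
  have sub: "B \<union> C \<subseteq> A" using Suc.prems(1) star_subset by simp
  have "\<rho> L (lf M) dvd \<rho> L q" if M: "M \<in> B \<union> C - {L}" for M
  proof -
    have LM: "L \<in> star P" "M \<in> star P" "L \<noteq> M" using L M Suc.prems(1) by blast+
    then have "L \<in> A" "M \<in> A" using star_subset by blast+
    then show ?thesis
      using \<rho>_dvd_iff[of L M q] inter_eq_if_subset_star[OF P LM] q LM(3) by simp
  qed
  \<comment> \<open>One factor \<open>q\<close> is spent for each remaining form, which explains the
    exponent below.\<close>
  then have "\<rho> L (forms_prod (B \<union> C - {L})) dvd (\<Prod>M\<in>B \<union> C - {L}. \<rho> L q)"
    unfolding \<rho>_forms_prod by (intro prod_dvd_prod)
  then have "\<rho> L (forms_prod (B \<union> C - {L})) dvd \<rho> L (q ^ card (B \<union> C - {L}))"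
    by simp
  then obtain z r where p: "q ^ card (B \<union> C - {L}) = z * (forms_prod C * D (forms_prod B)) + lf L * r"
    using Q_division[OF sub Suc.prems(2) L] by blast
  have "n = card (B - {L})" using Suc.hyps(2) L by simp
  moreover have "(B - {L}) \<union> insert L C = star P" "(B - {L}) \<inter> insert L C = {}"
    using Suc.prems(1,2) L by blast+
  ultimately obtain k where "q ^ k \<in> Q (B - {L}) (insert L C)" using Suc.hyps(1) by blast
  then have "r * q ^ k \<in> Q (B - {L}) (insert L C)" by (rule Q_mult)
  then have "lf L * (r * q ^ k) \<in> Q B C" using lf_mult_in_Q_iff[OF sub Suc.prems(2) L] by blast
  moreover have "(q ^ k * z) * (forms_prod C * D (forms_prod B)) \<in> Q B C"
    by (intro Q_mult Q_generators)
  ultimately have "(q ^ k * z) * (forms_prod C * D (forms_prod B)) + lf L * (r * q ^ k) \<in> Q B C"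
    by (intro Q_add)
  also have "(q ^ k * z) * (forms_prod C * D (forms_prod B)) + lf L * (r * q ^ k)
      = q ^ (k + card (B \<union> C - {L}))"
    unfolding power_add p by (simp add: algebra_simps)
  finally show ?case by blast
qed

text \<open>With \<open>C = {}\<close> this is the hard inclusion of the decomposition; the general
  \<open>C\<close> makes the statement stable under moving \<open>L\<close>.\<close>

lemma in_Q_if_in_local_Q:
  assumes "B \<union> C = A" "B \<inter> C = {}"
    and "\<And>P. P \<in> codim_two_intersections A \<Longrightarrow> p \<in> Q (B \<inter> star P) (C \<inter> star P)"
  shows "p \<in> Q B C"
  using assms
proof (induction "card B" arbitrary: B C p)
  case 0
  then have "B = {}" using finite_A by (metis card_0_eq finite_Un)
  then show ?case by simp
next
  case (Suc n)
  then obtain L where L: "L \<in> B" by fastforce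
  have sub: "B \<union> C \<subseteq> A" using Suc.prems(1) by simp
  have LA: "L \<in> A" using L Suc.prems(1) by blast
  have loc: "B \<inter> star P \<union> C \<inter> star P = star P" "B \<inter> star P \<inter> (C \<inter> star P) = {}"
    "B \<inter> star P \<union> C \<inter> star P \<subseteq> A" for P
    using Suc.prems(1,2) star_subset by blast+
  have "\<rho> L (forms_prod (A - {L})) dvd \<rho> L p"
    unfolding \<rho>_forms_prod
  \<comment> \<open>The forms are grouped by the intersection they cut out on \<open>L\<close>: each
    local ideal controls one group.\<close>
  proof (rule prod_prime_dvd_if_classes_dvd[where \<kappa> = "\<lambda>M. L \<inter> M"])
    show "finite (A - {L})" using finite_A by simp
    show "prime_elem (\<rho> L (lf M))" if "M \<in> A - {L}" for M using prime_\<rho>[OF LA] that by blast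
    show "L \<inter> M = L \<inter> N" if "M \<in> A - {L}" "N \<in> A - {L}" "\<rho> L (lf M) dvd \<rho> L (lf N)" for M N
    proof (rule inter_inj)
      have "lf N \<in> subspace_ideal (L \<inter> M)" using \<rho>_dvd_iff[OF LA] that by blast
      then show "L \<inter> M \<subseteq> L \<inter> N"
        using mem_iff_meval_lf[of N] that(2) by (auto simp: subspace_ideal_def)
    qed (use LA that inter_mem in blast)+
  next
    fix M assume M: "M \<in> A - {L}"
    define P where "P = L \<inter> M"
    have P: "P \<in> codim_two_intersections A" using M LA inter_mem unfolding P_def by blast
    have LP: "L \<in> star P" using LA by (auto simp: star_def P_def)
    have "\<rho> L (forms_prod (star P - {L})) dvd \<rho> L p"
      using \<rho>_dvd_if_in_Q[OF loc(3,2) _ Suc.prems(3)[OF P], of L] loc(1) L LP by simp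
    \<comment> \<open>A hyperplane other than \<open>L\<close> meets \<open>L\<close> in
      \<open>P\<close> exactly if it contains \<open>P\<close>.\<close>
    moreover have "{N \<in> A - {L}. L \<inter> N = L \<inter> M} = star P - {L}"
      using inter_eq_if_subset_star[OF P LP] unfolding P_def star_def by blast
    ultimately show "(\<Prod>N\<in>{N \<in> A - {L}. L \<inter> N = L \<inter> M}. \<rho> L (lf N)) dvd \<rho> L p"
      unfolding \<rho>_forms_prod by simp
  qed
  then obtain z r where p: "p = z * (forms_prod C * D (forms_prod B)) + lf L * r"
    using Q_division[OF sub Suc.prems(2) L] Suc.prems(1) by metis
  have "r \<in> Q (B - {L}) (insert L C)"
  proof (rule Suc.hyps(1))
    show "n = card (B - {L})" using Suc.hyps(2) L by simp
    show "(B - {L}) \<union> insert L C = A" "(B - {L}) \<inter> insert L C = {}"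
      using Suc.prems(1,2) L by blast+
  next
    fix P assume P: "P \<in> codim_two_intersections A"
    let ?B = "B \<inter> star P" and ?C = "C \<inter> star P"
    have "forms_prod C * D (forms_prod B) \<in> Q ?B ?C"
      using sub Suc.prems(2) by (rule generators_in_local_Q(2))
    then have "p - z * (forms_prod C * D (forms_prod B)) \<in> Q ?B ?C"
      by (rule Q_diff[OF Suc.prems(3)[OF P] Q_mult])
    then have r: "lf L * r \<in> Q ?B ?C" unfolding p by simp
    show "r \<in> Q ((B - {L}) \<inter> star P) (insert L C \<inter> star P)"
    \<comment> \<open>If \<open>L\<close> contains \<open>P\<close>, then \<open>lf L\<close> is
      divided out and moves in the local ideal too; otherwise \<open>lf L\<close> lies outside the
      prime ideal of \<open>P\<close> and cancels.\<close>
    proof (cases "L \<in> star P")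
      case True
      then have "r \<in> Q (?B - {L}) (insert L ?C)"
        using lf_mult_in_Q_iff[OF loc(3,2), of L] L r by blast
      moreover have "(B - {L}) \<inter> star P = ?B - {L}" "insert L C \<inter> star P = insert L ?C"
        using True by blast+
      ultimately show ?thesis by simp
    next
      case False
      then have "lf L \<notin> subspace_ideal P" using star_eq LA by blast
      then have "r \<in> Q ?B ?C" using local_cancel[OF P _ loc(1,2)] r by blast
      moreover have "(B - {L}) \<inter> star P = ?B" "insert L C \<inter> star P = ?C"
        using False by blast+
      ultimately show ?thesis by simp
    qed
  qed
  then have "lf L * r \<in> Q B C" using lf_mult_in_Q_iff[OF sub Suc.prems(2) L] by blast
  then show ?case unfolding p by (rule Q_add[OF Q_mult[OF Q_generators(2)]])
qed

end

subsection \<open>The primary decomposition\<close>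

context generic_derivative
begin

lemma Q_empty_right: "Q B {} = ring_ideal.span {forms_prod B, D (forms_prod B)}"
  by (simp add: Q_def)

lemma finite_star: "finite (star P)"
  using finite_A star_subset by (rule finite_subset[rotated])

text \<open>At least two forms of \<open>star P\<close> vanish on \<open>P\<close>, so after one is
  differentiated away another remains.\<close>

lemma local_Q_subset:
  assumes "P \<in> codim_two_intersections A"
  shows "Q (star P) {} \<subseteq> subspace_ideal P"
proof
  fix p assume "p \<in> Q (star P) {}"
  then obtain x y where p: "p = x * forms_prod (star P) + y * D (forms_prod (star P))"
    unfolding Q_iff by auto
  obtain H M where HM: "H \<in> star P" "M \<in> star P" "H \<noteq> M" "P = H \<inter> M"
    using assms by (rule codim_two_intersectionsE)
  have "meval z p = 0" if "z \<in> P" for z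
  proof -
    have "meval z (lf H) = 0" "meval z (lf M) = 0"
      using that HM mem_iff_meval_lf star_subset by blast+
    then have "meval z (forms_prod (star P)) = 0" "meval z (forms_prod (star P - {H})) = 0"
      using forms_prod_remove[of "star P" H] forms_prod_remove[of "star P - {H}" M] finite_star HM
      by simp_all
    then show ?thesis
      unfolding p D_forms_prod[OF finite_star HM(1)] using \<open>meval z (lf H) = 0\<close> by simp
  qed
  then show "p \<in> subspace_ideal P" by (simp add: subspace_ideal_def)
qed

text \<open>At a common zero some form of \<open>star P\<close> vanishes, the derivative then forces
  a second one to vanish, and any two of them cut out \<open>P\<close>.\<close>

lemma mem_iff_local_Q_vanishes:
  assumes "P \<in> codim_two_intersections A"
  shows "x \<in> P \<longleftrightarrow> (\<forall>p\<in>Q (star P) {}. meval x p = 0)"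
proof
  assume "x \<in> P"
  then show "\<forall>p\<in>Q (star P) {}. meval x p = 0"
    using local_Q_subset[OF assms] by (auto simp: subspace_ideal_def)
next
  assume vanish: "\<forall>p\<in>Q (star P) {}. meval x p = 0"
  then have "meval x (forms_prod (star P)) = 0" using Q_generators(1) by blast
  then obtain H where H: "H \<in> star P" "meval x (lf H) = 0"
    using finite_star by (auto simp: forms_prod_def)
  have "H \<in> A" using H star_subset by blast
  have "meval x (D (forms_prod (star P))) = 0"
    using vanish Q_generators(2)[of "{}" "star P"] by simp
  then have "meval x (forms_prod (star P - {H})) = 0"
    unfolding D_forms_prod[OF finite_star H(1)] using H(2) meval_generic[OF \<open>H \<in> A\<close>] by simp
  then obtain M where M: "M \<in> star P - {H}" "meval x (lf M) = 0"
    using finite_star by (auto simp: forms_prod_def)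
  have "M \<in> A" using M star_subset by blast
  then have "x \<in> H \<inter> M" using H M \<open>H \<in> A\<close> mem_iff_meval_lf by blast
  then show "x \<in> P" using inter_eq_if_subset_star[OF assms H(1), of M] M(1) by auto
qed

text \<open>On one hyperplane through \<open>P\<close>, membership in the ideal is divisibility by
  the prime restriction of a second form.\<close>

lemma subspace_ideal_prime:
  assumes "P \<in> codim_two_intersections A" "p * q \<in> subspace_ideal P"
  shows "p \<in> subspace_ideal P \<or> q \<in> subspace_ideal P"
proof -
  obtain H M where HM: "H \<in> star P" "M \<in> star P" "H \<noteq> M" "P = H \<inter> M"
    using assms(1) by (rule codim_two_intersectionsE)
  then have "H \<in> A" "M \<in> A" using star_subset by blast+
  note dvd_iff = \<rho>_dvd_iff[OF this HM(3), folded HM(4)]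
    and prime = prime_\<rho>[OF this HM(3)]
  have "\<rho> H (lf M) dvd \<rho> H p * \<rho> H q"
    using assms(2) dvd_iff[of "p * q"] by (simp only: restrict_along_mult)
  then show ?thesis using prime_elem_dvd_multD[OF prime] dvd_iff by blast
qed

lemma one_notin_subspace_ideal:
  "P \<in> codim_two_intersections A \<Longrightarrow> 1 \<notin> subspace_ideal P"
  using zero_mem by (auto simp: subspace_ideal_def)

lemma subspace_ideal_power:
  assumes "P \<in> codim_two_intersections A" "p ^ k \<in> subspace_ideal P"
  shows "p \<in> subspace_ideal P"
  using assms(2)
  by (induction k) (use subspace_ideal_prime one_notin_subspace_ideal assms(1) in auto)

lemma primary_ideal_local_Q:
  assumes "P \<in> codim_two_intersections A"
  shows "primary_ideal (Q (star P) {})"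
  unfolding primary_ideal_def
proof (intro conjI allI impI)
  show "ring_ideal.subspace (Q (star P) {})" by (rule subspace_Q)
  show "Q (star P) {} \<noteq> UNIV"
    using local_Q_subset[OF assms] one_notin_subspace_ideal[OF assms] by blast
  show "p \<in> Q (star P) {} \<or> (\<exists>k. q ^ k \<in> Q (star P) {})" if "p * q \<in> Q (star P) {}" for p q
  proof (cases "q \<in> subspace_ideal P")
    case True
    then show ?thesis using local_power[OF assms True, of "star P" "{}"] by simp
  next
    case False
    then show ?thesis
      using local_cancel[OF assms False, of "star P" "{}" p] that by (simp add: mult.commute)
  qed
qed

lemma ideal_radical_local_Q:
  assumes "P \<in> codim_two_intersections A"
  shows "ideal_radical (Q (star P) {}) = subspace_ideal P"
proof
  show "ideal_radical (Q (star P) {}) \<subseteq> subspace_ideal P"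
    using local_Q_subset[OF assms] subspace_ideal_power[OF assms] by (auto simp: ideal_radical_def)
  show "subspace_ideal P \<subseteq> ideal_radical (Q (star P) {})"
    using local_power[OF assms, of _ "star P" "{}"] by (auto simp: ideal_radical_def)
qed

lemma subset_if_subspace_ideal_subset:
  assumes "P \<in> codim_two_intersections A" "subspace_ideal P \<subseteq> subspace_ideal P'"
  shows "P' \<subseteq> P"
proof
  fix x assume "x \<in> P'"
  then show "x \<in> P"
    using mem_iff_local_Q_vanishes[OF assms(1)] local_Q_subset[OF assms(1)] assms(2)
    unfolding subspace_ideal_def by blast
qed

lemma minimal_primary_decomposition_Q:
  "minimal_primary_decomposition (Q A {}) (codim_two_intersections A) (\<lambda>P. Q (star P) {})"
  unfolding minimal_primary_decomposition_def
proof (intro conjI ballI)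
  show "finite (codim_two_intersections A)" by (rule finite_codim_two_intersections)
  show "Q A {} = (\<Inter>P\<in>codim_two_intersections A. Q (star P) {})"
  proof (intro antisym subsetI INT_I)
    fix p P assume p: "p \<in> Q A {}"
    have "A \<inter> star P = star P" using star_subset by blast
    then have gens: "forms_prod A \<in> Q (star P) {}" "forms_prod {} * D (forms_prod A) \<in> Q (star P) {}"
      using generators_in_local_Q[of A "{}" "star P"] by simp_all
    obtain x y where p: "p = x * forms_prod A + y * (forms_prod {} * D (forms_prod A))"
      using p unfolding Q_iff by blast
    show "p \<in> Q (star P) {}" unfolding p by (rule Q_add[OF Q_mult Q_mult, OF gens])
  next
    fix p assume p: "p \<in> (\<Inter>P\<in>codim_two_intersections A. Q (star P) {})"
    show "p \<in> Q A {}"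
    proof (rule in_Q_if_in_local_Q)
      fix P assume "P \<in> codim_two_intersections A"
      moreover have "A \<inter> star P = star P" using star_subset by blast
      ultimately show "p \<in> Q (A \<inter> star P) ({} \<inter> star P)" using p by simp
    qed simp_all
  qed
next
  fix P assume "P \<in> codim_two_intersections A"
  then show "primary_ideal (Q (star P) {})" by (rule primary_ideal_local_Q)
next
  show "inj_on (\<lambda>P. ideal_radical (Q (star P) {})) (codim_two_intersections A)"
  proof (rule inj_onI)
    fix P P' assume "P \<in> codim_two_intersections A" "P' \<in> codim_two_intersections A"
      and "ideal_radical (Q (star P) {}) = ideal_radical (Q (star P') {})"
    then show "P = P'"
      using ideal_radical_local_Q subset_if_subspace_ideal_subset by (metis equalityI order_refl)
  qed
next
  fix P assume P: "P \<in> codim_two_intersections A"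
  let ?J = "codim_two_intersections A - {P}"
  \<comment> \<open>For irredundancy, an element of each other component is chosen outside the prime
    ideal of \<open>P\<close>. The product of these lies in all other components but not in that of
    \<open>P\<close>.\<close>
  have "\<exists>q. q \<in> Q (star P') {} \<and> q \<notin> subspace_ideal P" if "P' \<in> ?J" for P'
  proof -
    have P': "P' \<in> codim_two_intersections A" "P' \<noteq> P" using that by blast+
    then obtain x where "x \<in> P" "x \<notin> P'" using inter_inj[OF P] by blast
    then show ?thesis using mem_iff_local_Q_vanishes[OF P'(1)] by (auto simp: subspace_ideal_def)
  qed
  then obtain q where q: "\<And>P'. P' \<in> ?J \<Longrightarrow> q P' \<in> Q (star P') {}"
    "\<And>P'. P' \<in> ?J \<Longrightarrow> q P' \<notin> subspace_ideal P" by metis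
  have fin: "finite ?J" using finite_codim_two_intersections by simp
  have "(\<Prod>P'\<in>J. q P') \<notin> subspace_ideal P" if "J \<subseteq> ?J" for J
    using finite_subset[OF that fin] that
  proof (induction J rule: finite_induct)
    case empty
    then show ?case using one_notin_subspace_ideal[OF P] by simp
  next
    case (insert P' J)
    then show ?case using q(2)[of P'] subspace_ideal_prime[OF P] by auto
  qed
  then have "(\<Prod>P'\<in>?J. q P') \<notin> Q (star P) {}" using local_Q_subset[OF P] by blast
  moreover have "(\<Prod>P'\<in>?J. q P') \<in> Q (star P') {}" if "P' \<in> ?J" for P'
  proof -
    have "(\<Prod>P'\<in>?J. q P') = (\<Prod>P'\<in>?J - {P'}. q P') * q P'"
      unfolding prod.remove[OF fin that] by (rule mult.commute)
    then show ?thesis using Q_mult[OF q(1)[OF that]] by simp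
  qed
  ultimately show "\<not> (\<Inter>P'\<in>?J. Q (star P') {}) \<subseteq> Q (star P) {}" by blast
qed

section \<open>The complete intersection property\<close>

text \<open>With at most one hyperplane a generator is a unit; with two, the ideal lies in a proper
  local component.\<close>

lemma Q_neq_UNIV:
  assumes "2 \<le> card A"
  shows "Q A {} \<noteq> UNIV"
proof -
  obtain H M where "H \<in> A" "M \<in> A" "H \<noteq> M"
    using assms card_le_Suc0_iff_eq[OF finite_A] by fastforce
  then have P: "H \<inter> M \<in> codim_two_intersections A" by (rule inter_mem)
  then have "Q A {} \<subseteq> Q (star (H \<inter> M)) {}"
    using minimal_primary_decomposition_Q unfolding minimal_primary_decomposition_def by blast
  then show ?thesis using local_Q_subset[OF P] one_notin_subspace_ideal[OF P] by blast
qed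

text \<open>No form \<open>lf H\<close> divides the derivative: on \<open>H\<close> it becomes a
  unit times the product of the other forms, which is nonzero.\<close>

lemma weakly_regular_forms_prod: "weakly_regular_sequence [forms_prod A, D (forms_prod A)]"
proof -
  have "forms_prod A dvd q" if dvd: "forms_prod A dvd D (forms_prod A) * q" for q
    using dvd unfolding forms_prod_def
  proof (rule prod_prime_dvd_mult_cancel[OF finite_A, rotated -1])
    fix H assume H: "H \<in> A"
    show "prime_elem (lf H)" by (rule prime_lf[OF H])
    have "\<not> lf H dvd forms_prod (A - {H})" using lf_dvd_forms_prod_iff[OF H, of "A - {H}"] by blast
    then have "\<rho> H (forms_prod (A - {H})) \<noteq> 0" unfolding lf_dvd_iff_\<rho>[OF H] .
    moreover have "u H \<noteq> 0" using w_u[of A "{}" H] H by auto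
    moreover have "\<rho> H (D (forms_prod A)) = u H * \<rho> H (forms_prod (A - {H}))"
      using \<rho>_second_generator[of A "{}" H] H by simp
    ultimately have "\<rho> H (D (forms_prod A)) \<noteq> 0" by simp
    then show "\<not> lf H dvd D (\<Prod>H\<in>A. lf H)"
      unfolding lf_dvd_iff_\<rho>[OF H] forms_prod_def .
  qed
  moreover have "p \<in> ring_ideal.span {forms_prod A} \<longleftrightarrow> forms_prod A dvd p" for p
    by (auto simp: ring_ideal.span_singleton dvd_def mult.commute)
  ultimately have second: "D (forms_prod A) * q \<in> ring_ideal.span {forms_prod A}
      \<Longrightarrow> q \<in> ring_ideal.span {forms_prod A}" for q
    by blast
  have first: "forms_prod A * q \<in> ring_ideal.span {} \<Longrightarrow> q \<in> ring_ideal.span {}" for q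
    using forms_prod_neq_0[of A] by simp
  show ?thesis
    unfolding weakly_regular_sequence_def
  proof (intro allI impI)
    fix i q
    let ?fs = "[forms_prod A, D (forms_prod A)]"
    assume "i < length ?fs" and q: "?fs ! i * q \<in> ring_ideal.span (set (take i ?fs))"
    then consider "i = 0" | "i = 1" by fastforce
    then show "q \<in> ring_ideal.span (set (take i ?fs))"
    proof cases
      case 1
      show ?thesis using first[of q] q unfolding 1 by simp
    next
      case 2
      show ?thesis using second[of q] q unfolding 2 by simp
    qed
  qed
qed

end

subsection \<open>Counting pairs of hyperplanes\<close>

lemma keys_linear_form_subset:
  "Poly_Mapping.keys (linear_form b) \<subseteq> range (\<lambda>i. Poly_Mapping.single i 1)"
proof -
  have "Poly_Mapping.keys (linear_form b)
      \<subseteq> (\<Union>i\<in>UNIV. Poly_Mapping.keys (mconst (b $ i) * mvar i))"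
    unfolding linear_form_def by (rule Poly_Mapping.keys_sum)
  also have "\<dots> \<subseteq> range (\<lambda>i. Poly_Mapping.single i 1)"
    by (auto simp: mconst_def mvar_def mult_single split: if_splits)
  finally show ?thesis .
qed

text \<open>Every exponent vector occurring in the product has total degree \<open>card I\<close>,
  and some vector occurs because the product is nonzero.\<close>

lemma mdegree_prod_linear_form:
  fixes b :: "'i \<Rightarrow> ('k::field_char_0, 'n::{finite,linorder}) vec"
  assumes "finite I" "\<And>i. i \<in> I \<Longrightarrow> b i \<noteq> 0"
  shows "mdegree (\<Prod>i\<in>I. linear_form (b i)) = card I"
proof -
  let ?d = "\<lambda>m. \<Sum>j\<in>UNIV. Poly_Mapping.lookup m (j::'n)"
  have "?d m = card I" if "m \<in> Poly_Mapping.keys (\<Prod>i\<in>I. linear_form (b i))" for m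
    using assms(1) that
  proof (induction I arbitrary: m rule: finite_induct)
    case (insert i I)
    then obtain m1 m2 where m: "m = m1 + m2" "m1 \<in> Poly_Mapping.keys (linear_form (b i))"
      "m2 \<in> Poly_Mapping.keys (\<Prod>i\<in>I. linear_form (b i))"
      using keys_mult[of "linear_form (b i)" "\<Prod>i\<in>I. linear_form (b i)"] by auto
    obtain j where "m1 = Poly_Mapping.single j 1" using m(2) keys_linear_form_subset by blast
    then have "?d m1 = 1" by (simp add: lookup_single when_def)
    then show ?case
      using insert.IH[OF m(3)] insert.hyps m(1) by (simp add: lookup_add sum.distrib)
  qed simp
  moreover have "(\<Prod>i\<in>I. linear_form (b i)) \<noteq> 0"
    using assms prime_elem_linear_form by (auto simp: prime_elem_def)
  then have "Poly_Mapping.keys (\<Prod>i\<in>I. linear_form (b i)) \<noteq> {}" by simp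
  ultimately have "?d ` Poly_Mapping.keys (\<Prod>i\<in>I. linear_form (b i)) = {card I}" by fastforce
  then show ?thesis unfolding mdegree_def by simp
qed

lemma card_off_diagonal:
  assumes "finite X"
  shows "card (SIGMA x:X. X - {x}) = card X * (card X - 1)"
  using assms by (simp add: card_SigmaI)

context hyperplane_forms
begin

lemma local_mult_eq: "local_mult A \<alpha> P = card (star P)"
  unfolding local_mult_def local_poly_eq forms_prod_def
  by (rule mdegree_prod_linear_form)
    (use finite_subset[OF star_subset finite_A] \<alpha>_neq_0 star_subset in auto)

text \<open>Double counting in place of a degree computation: each ordered pair of distinct
  hyperplanes \<open>H\<close>, \<open>M\<close> lies in \<open>star P\<close> for exactly one
  \<open>P\<close>, namely \<open>H \<inter> M\<close>.\<close>

lemma card_pairs: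
  "card A * (card A - 1) = (\<Sum>P\<in>codim_two_intersections A. card (star P) * (card (star P) - 1))"
proof -
  let ?off = "\<lambda>X. SIGMA H:X. X - {H}"
  have fin: "finite (star P)" for P using finite_subset[OF star_subset finite_A] .
  have "?off A = (\<Union>P\<in>codim_two_intersections A. ?off (star P))"
    using inter_mem star_subset by (auto simp: star_def)
  then have "card (?off A) = card (\<Union>P\<in>codim_two_intersections A. ?off (star P))" by simp
  also have "\<dots> = (\<Sum>P\<in>codim_two_intersections A. card (?off (star P)))"
  proof (rule card_UN_disjoint)
    show "\<forall>P\<in>codim_two_intersections A. \<forall>P'\<in>codim_two_intersections A.
        P \<noteq> P' \<longrightarrow> ?off (star P) \<inter> ?off (star P') = {}"
      using inter_eq_if_subset_star by blast
  qed (use fin finite_codim_two_intersections in auto)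
  finally show ?thesis by (simp only: card_off_diagonal fin finite_A)
qed

end

theorem lemma4p4:
  fixes A :: "('k::field_char_0, 'n::{finite,linorder}) vec set set"
  assumes "hyperplane_arrangement A"
  shows "(\<exists>U :: ('k, 'n) vec set. zariski_open U \<and> U \<noteq> {} \<and>
      (\<forall>\<alpha> a. defining_forms A \<alpha> \<longrightarrow> a \<in> U \<longrightarrow>
        (let f = arrangement_poly A \<alpha>; f' = form_derivative a f in
          weakly_regular_sequence [f, f'] \<and>
          (2 \<le> card A \<longrightarrow> regular_sequence [f, f']) \<and>
          minimal_primary_decomposition (ring_ideal.span {f, f'}) (codim_two_intersections A)
            (\<lambda>P. let g = local_poly A \<alpha> P in ring_ideal.span {g, form_derivative a g}))))
    \<and> (\<forall>\<alpha>. defining_forms A \<alpha> \<longrightarrow>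
        card A * (card A - 1)
          = (\<Sum>P\<in>codim_two_intersections A. local_mult A \<alpha> P * (local_mult A \<alpha> P - 1)))"
proof (intro conjI allI impI)
  have finite_A: "finite A" using assms by (simp add: hyperplane_arrangement_def)
  then have loc: "hyperplane_forms A \<alpha>" if "defining_forms A \<alpha>" for \<alpha>
    using that by unfold_locales
  show "card A * (card A - 1)
      = (\<Sum>P\<in>codim_two_intersections A. local_mult A \<alpha> P * (local_mult A \<alpha> P - 1))"
    if "defining_forms A \<alpha>" for \<alpha>
  proof -
    interpret hyperplane_forms A \<alpha> using loc that .
    show ?thesis unfolding local_mult_eq by (rule card_pairs)
  qed
  \<comment> \<open>The open set has to be fixed before \<open>\<alpha>\<close> is given. An
    auxiliary choice of forms shows that the complement of the hyperplanes, which depends on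
    \<open>A\<close> alone, is the locus where one polynomial is nonzero.\<close>
  obtain \<beta> where "defining_forms A \<beta>"
    using assms unfolding hyperplane_arrangement_def defining_forms_def by metis
  then interpret \<beta>: hyperplane_forms A \<beta> by (rule loc)
  have U: "- \<Union>A = {a. \<exists>p\<in>{\<beta>.forms_prod A}. meval a p \<noteq> 0}"
    using finite_A \<beta>.mem_iff_meval_lf by (auto simp: \<beta>.forms_prod_def)
  show "\<exists>U. zariski_open U \<and> U \<noteq> {} \<and>
      (\<forall>\<alpha> a. defining_forms A \<alpha> \<longrightarrow> a \<in> U \<longrightarrow>
        (let f = arrangement_poly A \<alpha>; f' = form_derivative a f in
          weakly_regular_sequence [f, f'] \<and>
          (2 \<le> card A \<longrightarrow> regular_sequence [f, f']) \<and>
          minimal_primary_decomposition (ring_ideal.span {f, f'}) (codim_two_intersections A)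
            (\<lambda>P. let g = local_poly A \<alpha> P in ring_ideal.span {g, form_derivative a g})))"
  proof (intro exI[of _ "- \<Union>A"] conjI allI impI)
    show "zariski_open (- \<Union>A)" unfolding zariski_open_def using U by blast
    \<comment> \<open>A product of nonzero forms is a nonzero polynomial, so in characteristic zero
      it is nonzero at some point.\<close>
    show "- \<Union>A \<noteq> {}"
      using meval_eq_0_imp_eq_0[of "\<beta>.forms_prod A"] \<beta>.forms_prod_neq_0[of A] unfolding U by auto
  next
    fix \<alpha> a assume \<alpha>: "defining_forms A \<alpha>" and a: "a \<in> - \<Union>A"
    interpret hyperplane_forms A \<alpha> using loc \<alpha> .
    interpret generic_derivative A \<alpha> a using a by unfold_locales simp
    show "let f = arrangement_poly A \<alpha>; f' = form_derivative a f in
        weakly_regular_sequence [f, f'] \<and>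
        (2 \<le> card A \<longrightarrow> regular_sequence [f, f']) \<and>
        minimal_primary_decomposition (ring_ideal.span {f, f'}) (codim_two_intersections A)
          (\<lambda>P. let g = local_poly A \<alpha> P in ring_ideal.span {g, form_derivative a g})"
      using weakly_regular_forms_prod Q_neq_UNIV minimal_primary_decomposition_Q
      unfolding Let_def arrangement_poly_eq local_poly_eq Q_empty_right regular_sequence_def
      by simp
  qed
qed

end
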